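(* Let $r\ge 2$ and let $\mathcal{H}=\{H_1,H_2,\ldots,H_\ell\}$ be a finite family of nontrivial balanced $r$-graphs. Write $v_i=v(H_i)$, $e_i=e(H_i)$ and $\rho_i=\rho(H_i)$, and assume that $\rho_i\le\rho_{i+1}$ for $1\le i<\ell$. Define $s$ by $\rho=\rho_1=\rho_2=\cdots=\rho_s<\rho_{s+1}$ (with $s=\ell$ if all $\rho_i$ are equal), and assume that $\rho>1/(r-1)$. For each $i$ and each edge $e$ of $H_i$, let $\alpha_i(e)$ be the number of automorphisms of $H_i$ that map $e$ to itself, and let $\alpha_i=\min_e\alpha_i(e)$. Let $c_1>0$ be the (positive) solution of $$\sum_{i=1}^s\frac{e_ix^{e_i-1}}{\alpha_i}=\frac{1}{50\,r!},$$ and let $$c_2=\max\left\{\left(\frac{\alpha_i}{5e_ic_1^{e_i-1}r!}\right)^{1/(r-1)}:\ i=1,2,\ldots,s\right\}\quad(\text{so that } c_2\ge 10^{1/(r-1)}).$$ Then for all sufficiently large $k$, $$m_k(\mathcal{H})<c_{\mathcal{H}}\,(k^{r-1}\log k)^{(r-1/\rho)/(r-1-1/\rho)},$$ where $$c_{\mathcal{H}}=2\left(\frac{r!}{c_1}\right)^{1/(r-1-1/\rho)}c_2^{(r-1)(r-1/\rho)/(r-1-1/\rho)}\left(\frac{r-1}{r-1-1/\rho}\right)^{(r-1/\rho)/(r-1-1/\rho)}.$$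
   Context: An $r$-graph is a hypergraph all of whose edges have exactly $r$ vertices. The chromatic number of a hypergraph is the minimum number of colors in a coloring of its vertices such that no edge is monochromatic. A hypergraph is nontrivial if it has at least two edges. For a collection $\mathcal{H}$ of $r$-graphs, an $r$-graph is $\mathcal{H}$-free if it contains no member of $\mathcal{H}$ as a (not necessarily induced) subhypergraph, and $m_k(\mathcal{H})$ denotes the minimum number of edges in an $\mathcal{H}$-free $r$-graph with chromatic number greater than $k$. For a nontrivial $r$-graph $H$, $\rho(H)=\max_{H'\subseteq H}\frac{e'-1}{v'-r}$, the maximum over nontrivial subhypergraphs $H'$ of $H$ with $v'$ vertices and $e'$ edges; $H$ is balanced if $\rho(H)=\frac{e(H)-1}{v(H)-r}$. Here $\log$ is the natural logarithm. *)

theory Defs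
  imports "HOL-Library.Extended_Real" "HOL-Combinatorics.Permutations"
begin

datatype 'a hypergraph = Hypergraph (verts: "'a set") (edges: "'a set set")

definition r_graph :: "nat \<Rightarrow> 'a hypergraph \<Rightarrow> bool" where
  "r_graph r G \<longleftrightarrow> finite (verts G) \<and> (\<forall>e\<in>edges G. e \<subseteq> verts G \<and> card e = r)"

definition nontrivial :: "'a hypergraph \<Rightarrow> bool" where
  "nontrivial G \<longleftrightarrow> 2 \<le> card (edges G)"

definition subhypergraph :: "'a hypergraph \<Rightarrow> 'a hypergraph \<Rightarrow> bool" where
  "subhypergraph G' G \<longleftrightarrow>
     verts G' \<subseteq> verts G \<and> edges G' \<subseteq> edges G \<and> (\<forall>e\<in>edges G'. e \<subseteq> verts G')"

definition isomorphic :: "'a hypergraph \<Rightarrow> 'b hypergraph \<Rightarrow> bool" where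
  "isomorphic G H \<longleftrightarrow>
     (\<exists>f. bij_betw f (verts G) (verts H) \<and> (\<lambda>e. f ` e) ` edges G = edges H)"

definition free_of :: "'a hypergraph set \<Rightarrow> 'b hypergraph \<Rightarrow> bool" where
  "free_of \<H> G \<longleftrightarrow> \<not> (\<exists>H\<in>\<H>. \<exists>G'. subhypergraph G' G \<and> isomorphic H G')"

definition colorable :: "nat \<Rightarrow> 'a hypergraph \<Rightarrow> bool" where
  "colorable k G \<longleftrightarrow>
     (\<exists>c. c ` verts G \<subseteq> {..<k} \<and> (\<forall>e\<in>edges G. \<not> (\<exists>i. \<forall>v\<in>e. c v = i)))"

text \<open>Both minima below are taken in \<^typ>\<open>enat\<close>, so that a minimum over the empty set is
  \<^term>\<open>\<infinity>\<close> rather than a junk number.\<close>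

definition chromatic_number :: "'a hypergraph \<Rightarrow> enat" where
  "chromatic_number G = Inf {enat k | k. colorable k G}"

text \<open>Every finite hypergraph is isomorphic to one whose vertices are natural numbers, so it
  suffices to minimise over those.\<close>

definition min_edges :: "nat \<Rightarrow> nat \<Rightarrow> 'a hypergraph set \<Rightarrow> enat" where
  "min_edges r k \<H> = Inf {enat (card (edges G)) | G :: nat hypergraph.
     r_graph r G \<and> free_of \<H> G \<and> enat k < chromatic_number G}"

definition density :: "nat \<Rightarrow> 'a hypergraph \<Rightarrow> real" where
  "density r H = (real (card (edges H)) - 1) / (real (card (verts H)) - real r)"

text \<open>In a nontrivial \<open>r\<close>-graph the maximum is over a finite nonempty set, and every
  denominator is positive because two distinct \<open>r\<close>-sets span more than \<open>r\<close> vertices.\<close>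

definition rho :: "nat \<Rightarrow> 'a hypergraph \<Rightarrow> real" where
  "rho r H = Max {density r H' | H'. subhypergraph H' H \<and> nontrivial H'}"

definition balanced :: "nat \<Rightarrow> 'a hypergraph \<Rightarrow> bool" where
  "balanced r H \<longleftrightarrow> rho r H = density r H"

text \<open>A permutation in the sense of \<^const>\<open>permutes\<close> is the identity outside the vertex set, so
  each automorphism is counted exactly once. The edge \<open>e\<close> is fixed as a set, not pointwise.\<close>

definition edge_auts :: "'a hypergraph \<Rightarrow> 'a set \<Rightarrow> nat" where
  "edge_auts H e =
     card {f. f permutes verts H \<and> (\<lambda>d. f ` d) ` edges H = edges H \<and> f ` e = e}"

definition min_edge_auts :: "'a hypergraph \<Rightarrow> nat" where
  "min_edge_auts H = Min (edge_auts H ` edges H)"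

end

theory Submission imports
  Defs
  Complex_Main
  "HOL-Library.Disjoint_Sets"
  "HOL-Real_Asymp.Real_Asymp"
begin

text \<open>
  Write \<open>a = 1/\<rho>\<close> and \<open>D = r - 1 - a\<close>. Take a random \<open>r\<close>-graph on \<open>n = k t\<close> vertices with edge
  probability \<open>p = c\<^sub>1 n powr (-a)\<close>, and delete all edges of a maximal family \<open>F\<close> of pairwise
  edge-disjoint copies of members of \<open>\<H>\<close>; by maximality the result is \<open>\<H>\<close>-free. Every
  \<open>k\<close>-colouring has a class containing a \<open>t\<close>-set \<open>S\<close>, so the result is not \<open>k\<close>-colourable unless all
  random edges inside some \<open>S\<close> lie in \<open>\<Union>F\<close>. A union bound over the members of \<open>F\<close> having an edge
  inside \<open>S\<close> bounds the probability of the latter by \<open>exp (-p (t choose r) + q)\<close>, where \<open>q\<close> is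
  asymptotically the expected number of copies with an edge inside \<open>S\<close>. Since \<open>\<rho>\<^sub>i = (e\<^sub>i - 1)/(v\<^sub>i - r)\<close>, the
  choice of \<open>c\<^sub>1\<close> makes \<open>q\<close> at most about \<open>p (t choose r) / 50\<close>, the graphs with \<open>\<rho>\<^sub>i > \<rho>\<close>
  contributing a smaller order. So it suffices that \<open>p (t choose r)\<close> be at least \<open>2 t ln k\<close>, which
  beats the number \<open>exp (t (1 + ln k))\<close> of choices of \<open>S\<close>; this holds if \<open>t powr D\<close> is about
  \<open>8 r! k powr a ln k / c\<^sub>1\<close>. Twice the expected number of edges is then below the claimed bound because
  \<open>8 < 10 \<le> c\<^sub>2 ^ (r-1)\<close> and \<open>D \<le> r - 1\<close>.
\<close>

section \<open>Random subsets of a finite set, by finite sums of weights\<close>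

text \<open>For \<open>G \<subseteq> E\<close> this is the probability that a random subset of
  \<open>E\<close>, containing each element independently with probability \<open>p\<close>, equals
  \<open>G\<close>.\<close>

definition weight :: "real \<Rightarrow> 'b set \<Rightarrow> 'b set \<Rightarrow> real" where
  "weight p E G = p ^ card G * (1 - p) ^ card (E - G)"

lemma weight_nonneg: "0 \<le> p \<Longrightarrow> p \<le> 1 \<Longrightarrow> 0 \<le> weight p E G"
  by (simp add: weight_def)

text \<open>The condition says that the elements of \<open>X\<close> are chosen and those of
  \<open>Y - X\<close> are not, so independence gives the product. In the proof, \<open>f\<close>
  and \<open>g\<close> vanish exactly where the condition is violated. This turns the restricted sum
  into a sum over all of \<open>Pow E\<close>, which \<open>prod_add\<close> factors
  elementwise.\<close>

lemma sum_weight_interval: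
  assumes "finite E" "X \<subseteq> E" "Y \<subseteq> E"
  shows "(\<Sum>G | G \<subseteq> E \<and> X \<subseteq> G \<and> G \<inter> Y \<subseteq> X. weight p E G) = p ^ card X * (1 - p) ^ card (Y - X)"
proof -
  define f where "f e = (if e \<in> Y - X then 0 else p)" for e
  define g where "g e = (if e \<in> X then 0 else 1 - p)" for e
  have "prod f G * prod g (E - G) = (if X \<subseteq> G \<and> G \<inter> Y \<subseteq> X then weight p E G else 0)"
    if "G \<subseteq> E" for G
  proof -
    have fin: "finite G" "finite (E - G)"
      using that assms(1) finite_subset by auto
    consider e where "e \<in> X" "e \<notin> G" | e where "e \<in> G" "e \<in> Y - X" | "X \<subseteq> G" "G \<inter> Y \<subseteq> X"
      by blast
    then show ?thesis
    proof cases
      case 1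
      then have "prod g (E - G) = 0"
        using fin assms by (intro prod_zero) (auto simp: g_def)
      with 1 show ?thesis by auto
    next
      case 2
      then have "prod f G = 0"
        using fin by (intro prod_zero) (auto simp: f_def)
      with 2 show ?thesis by auto
    next
      case 3
      have "prod f G = (\<Prod>e\<in>G. p)" "prod g (E - G) = (\<Prod>e\<in>E - G. 1 - p)"
        by (intro prod.cong; use 3 in \<open>auto simp: f_def g_def\<close>)+
      with 3 show ?thesis by (simp add: weight_def)
    qed
  qed
  then have "(\<Sum>G\<in>Pow E. prod f G * prod g (E - G))
      = (\<Sum>G\<in>Pow E. if X \<subseteq> G \<and> G \<inter> Y \<subseteq> X then weight p E G else 0)"
    by (intro sum.cong) auto
  also have "\<dots> = (\<Sum>G\<in>{G\<in>Pow E. X \<subseteq> G \<and> G \<inter> Y \<subseteq> X}. weight p E G)"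
    using assms(1) by (subst sum.inter_filter) auto
  also have "{G\<in>Pow E. X \<subseteq> G \<and> G \<inter> Y \<subseteq> X} = {G. G \<subseteq> E \<and> X \<subseteq> G \<and> G \<inter> Y \<subseteq> X}"
    by auto
  finally have "(\<Sum>G | G \<subseteq> E \<and> X \<subseteq> G \<and> G \<inter> Y \<subseteq> X. weight p E G) = (\<Prod>e\<in>E. f e + g e)"
    by (simp add: prod_add[OF assms(1)])
  also have "\<dots> = (\<Prod>e\<in>E. (if e \<in> X then p else 1) * (if e \<in> Y - X then 1 - p else 1))"
    by (intro prod.cong) (auto simp: f_def g_def)
  also have "\<dots> = (\<Prod>e\<in>E \<inter> X. p) * (\<Prod>e\<in>E \<inter> (Y - X). 1 - p)"
    by (simp add: prod.distrib prod.inter_restrict[OF assms(1)] del: prod_constant Diff_iff)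
  also have "E \<inter> X = X" using assms(2) by auto
  also have "E \<inter> (Y - X) = Y - X" using assms(3) by auto
  finally show ?thesis by simp
qed

lemma sum_weight: "finite E \<Longrightarrow> (\<Sum>G\<in>Pow E. weight p E G) = 1"
  using sum_weight_interval[of E "{}" "{}" p] by (simp add: Pow_def)

text \<open>Linearity of expectation: \<open>card G\<close> is split into indicators of its elements
  and the two sums are exchanged.\<close>

lemma sum_weight_card:
  assumes "finite E"
  shows "(\<Sum>G\<in>Pow E. weight p E G * real (card G)) = p * real (card E)"
proof -
  have "(\<Sum>G\<in>Pow E. weight p E G * real (card G))
      = (\<Sum>G\<in>Pow E. \<Sum>e\<in>E. if e \<in> G then weight p E G else 0)"
  proof (rule sum.cong)
    fix G assume "G \<in> Pow E"
    then have "E \<inter> G = G" by auto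
    then show "weight p E G * real (card G) = (\<Sum>e\<in>E. if e \<in> G then weight p E G else 0)"
      using assms by (simp flip: sum.inter_restrict)
  qed simp
  also have "\<dots> = (\<Sum>e\<in>E. \<Sum>G\<in>Pow E. if e \<in> G then weight p E G else 0)"
    by (rule sum.swap)
  also have "\<dots> = (\<Sum>e\<in>E. p)"
  proof (rule sum.cong)
    fix e assume "e \<in> E"
    have "(\<Sum>G\<in>Pow E. if e \<in> G then weight p E G else 0) = (\<Sum>G\<in>{G\<in>Pow E. e \<in> G}. weight p E G)"
      using assms by (subst sum.inter_filter) auto
    also have "{G\<in>Pow E. e \<in> G} = {G. G \<subseteq> E \<and> {e} \<subseteq> G \<and> G \<inter> {} \<subseteq> {e}}"
      by auto
    finally show "(\<Sum>G\<in>Pow E. if e \<in> G then weight p E G else 0) = p"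
      using sum_weight_interval[OF assms, of "{e}" "{}" p] \<open>e \<in> E\<close> by simp
  qed simp
  finally show ?thesis by simp
qed

section \<open>The deletion method for families of sets\<close>

lemma sum_UN_le:
  fixes f :: "'c \<Rightarrow> real"
  assumes "finite I" "\<And>i. i \<in> I \<Longrightarrow> finite (B i)" "\<And>x. 0 \<le> f x"
  shows "sum f (\<Union>i\<in>I. B i) \<le> (\<Sum>i\<in>I. sum f (B i))"
  using assms
proof (induction I rule: finite_induct)
  case (insert i I)
  have "sum f (B i \<union> (\<Union>j\<in>I. B j)) \<le> sum f (B i) + sum f (\<Union>j\<in>I. B j)"
    using insert by (subst sum.union_inter[symmetric]) (auto intro!: sum_nonneg)
  with insert show ?case by fastforce
qed simp

text \<open>The event that the edges of \<open>G\<close> in \<open>Y\<close> can all be lost by the deletion. Only the members of the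
  deleted family that meet \<open>Y\<close> are recorded, so that the union bound stays small.\<close>

definition deletion_bad :: "'b set set \<Rightarrow> 'b set \<Rightarrow> 'b set \<Rightarrow> bool" where
  "deletion_bad \<A> Y G \<longleftrightarrow>
     (\<exists>F \<subseteq> {A \<in> \<A>. A \<inter> Y \<noteq> {}}. disjoint F \<and> \<Union>F \<subseteq> G \<and> G \<inter> Y \<subseteq> \<Union>F)"

text \<open>Union bound over the possible families \<open>F\<close>. By disjointness,
  \<open>p ^ card (\<Union>F)\<close> is the product of the \<open>p ^ card A\<close>. Each
  \<open>A\<close> in \<open>F\<close> covers at most \<open>L\<close> elements of \<open>Y\<close>,
  so it costs at most a factor \<open>1 / (1 - p) ^ L\<close> compared with
  \<open>(1 - p) ^ card Y\<close>; this is the denominator of \<open>q A\<close>. The sum over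
  families is then at most the product of the \<open>1 + q A\<close>, hence at most an
  exponential.\<close>

lemma weight_deletion_bad_le:
  fixes p :: real and E Y :: "'b set"
  assumes E: "finite E" "\<And>A. A \<in> \<A> \<Longrightarrow> A \<subseteq> E \<and> card A \<le> L" and Y: "Y \<subseteq> E" and p: "0 < p" "p < 1"
  shows "(\<Sum>G | G \<subseteq> E \<and> deletion_bad \<A> Y G. weight p E G)
    \<le> exp (- p * card Y + (\<Sum>A | A \<in> \<A> \<and> A \<inter> Y \<noteq> {}. p ^ card A) / (1 - p) ^ L)"
proof -
  define B where "B = {A \<in> \<A>. A \<inter> Y \<noteq> {}}"
  have finB: "finite B"
    using E by (auto intro: finite_subset[of _ "Pow E"] simp: B_def)
  define \<F> where "\<F> = {F \<in> Pow B. disjoint F}"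
  have fin\<F>: "finite \<F>"
    using finB by (simp add: \<F>_def)
  define q where "q A = p ^ card A / (1 - p) ^ L" for A :: "'b set"
  have q0: "0 \<le> q A" for A
    using p by (simp add: q_def)
  have "(\<Sum>G | G \<subseteq> E \<and> deletion_bad \<A> Y G. weight p E G)
      \<le> (\<Sum>G\<in>(\<Union>F\<in>\<F>. {G. G \<subseteq> E \<and> \<Union>F \<subseteq> G \<and> G \<inter> Y \<subseteq> \<Union>F}). weight p E G)"
  proof (rule sum_mono2)
    show "{G. G \<subseteq> E \<and> deletion_bad \<A> Y G} \<subseteq> (\<Union>F\<in>\<F>. {G. G \<subseteq> E \<and> \<Union>F \<subseteq> G \<and> G \<inter> Y \<subseteq> \<Union>F})"
      by (fastforce simp: deletion_bad_def \<F>_def B_def)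
  qed (use p fin\<F> E(1) in \<open>auto intro: weight_nonneg\<close>)
  also have "\<dots> \<le> (\<Sum>F\<in>\<F>. \<Sum>G | G \<subseteq> E \<and> \<Union>F \<subseteq> G \<and> G \<inter> Y \<subseteq> \<Union>F. weight p E G)"
    using p E(1) by (intro sum_UN_le fin\<F>) (auto intro: weight_nonneg)
  also have "\<dots> \<le> (\<Sum>F\<in>\<F>. (1 - p) ^ card Y * (\<Prod>A\<in>F. q A))"
  proof (rule sum_mono)
    fix F assume F: "F \<in> \<F>"
    then have FB: "F \<subseteq> B" and disj: "disjoint F"
      by (simp_all add: \<F>_def)
    have UF: "\<Union>F \<subseteq> E"
    proof (rule Union_least)
      fix A assume "A \<in> F"
      with FB have "A \<in> \<A>" by (auto simp: B_def)
      then show "A \<subseteq> E" using E(2) by simp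
    qed
    have finA: "finite A" if "A \<in> F" for A
      using finite_subset[OF _ E(1)] Union_upper[OF that] UF by (meson order_trans)
    have cUF: "card (\<Union>F) = (\<Sum>A\<in>F. card A)"
      using disj finA by (intro card_Union_disjoint) (auto simp: disjoint_def pairwise_def disjnt_def)
    also have "\<dots> \<le> (\<Sum>A\<in>F. L)"
      using FB E(2) by (intro sum_mono) (auto simp: B_def)
    finally have cL: "card (\<Union>F) \<le> L * card F" by (simp add: mult.commute)
    have "Y \<subseteq> (Y - \<Union>F) \<union> \<Union>F" by auto
    then have "card Y \<le> card ((Y - \<Union>F) \<union> \<Union>F)"
      using finite_subset[OF Y E(1)] finite_subset[OF UF E(1)] by (intro card_mono) auto
    also have "\<dots> \<le> card (Y - \<Union>F) + card (\<Union>F)"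
      by (rule card_Un_le)
    finally have "(1 - p) ^ (card (Y - \<Union>F) + L * card F) \<le> (1 - p) ^ card Y"
      using p cL by (intro power_decreasing) auto
    then have le: "(1 - p) ^ card (Y - \<Union>F) \<le> (1 - p) ^ card Y / (1 - p) ^ (L * card F)"
      using p by (simp add: field_simps power_add)
    have "(\<Sum>G | G \<subseteq> E \<and> \<Union>F \<subseteq> G \<and> G \<inter> Y \<subseteq> \<Union>F. weight p E G)
        = p ^ (\<Sum>A\<in>F. card A) * (1 - p) ^ card (Y - \<Union>F)"
      using sum_weight_interval[OF E(1) UF Y] by (simp add: cUF)
    also have "\<dots> \<le> p ^ (\<Sum>A\<in>F. card A) * ((1 - p) ^ card Y / (1 - p) ^ (L * card F))"
      using p by (intro mult_left_mono le) auto
    also have "\<dots> = (1 - p) ^ card Y * (\<Prod>A\<in>F. q A)"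
      by (simp add: q_def prod_dividef power_sum power_mult)
    finally show "(\<Sum>G | G \<subseteq> E \<and> \<Union>F \<subseteq> G \<and> G \<inter> Y \<subseteq> \<Union>F. weight p E G)
      \<le> (1 - p) ^ card Y * (\<Prod>A\<in>F. q A)" .
  qed
  \<comment> \<open>Disjointness has served its purpose; giving it up lets the sum over all
    subfamilies of \<open>B\<close> factor.\<close>
  also have "\<dots> \<le> (\<Sum>F\<in>Pow B. (1 - p) ^ card Y * (\<Prod>A\<in>F. q A))"
    using finB p q0 by (intro sum_mono2) (auto simp: \<F>_def intro!: mult_nonneg_nonneg prod_nonneg)
  also have "\<dots> = (1 - p) ^ card Y * (\<Prod>A\<in>B. q A + 1)"
    by (simp add: prod_add[OF finB] sum_distrib_left)
  also have "\<dots> \<le> exp (- p) ^ card Y * (\<Prod>A\<in>B. exp (q A))"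
    using p q0 exp_ge_add_one_self[of "-p"] exp_ge_add_one_self
    by (intro mult_mono power_mono prod_mono) (auto simp: add.commute add_nonneg_nonneg intro!: prod_nonneg)
  also have "\<dots> = exp (- p * card Y + (\<Sum>A\<in>B. q A))"
    unfolding exp_add exp_sum[OF finB] by (simp add: mult.commute flip: exp_of_nat_mult)
  also have "(\<Sum>A\<in>B. q A) = (\<Sum>A | A \<in> \<A> \<and> A \<inter> Y \<noteq> {}. p ^ card A) / (1 - p) ^ L"
    by (simp add: q_def B_def sum_divide_distrib)
  finally show ?thesis .
qed

text \<open>An inclusion-maximal \<open>F\<close> works: a member of \<open>\<A>\<close> inside
  \<open>G - \<Union>F\<close> could be added to \<open>F\<close>, hence would already belong to
  \<open>F\<close> and be empty.\<close>

lemma maximal_disjoint_family: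
  assumes "finite \<A>" "{} \<notin> \<A>"
  obtains F where "F \<subseteq> \<A>" "disjoint F" "\<Union>F \<subseteq> G" "\<And>A. A \<in> \<A> \<Longrightarrow> \<not> A \<subseteq> G - \<Union>F"
proof -
  define \<F> where "\<F> = {F \<in> Pow \<A>. disjoint F \<and> \<Union>F \<subseteq> G}"
  have "finite \<F>" "{} \<in> \<F>"
    using assms(1) by (auto simp: \<F>_def)
  then obtain F where F: "F \<in> \<F>" "\<And>F'. F' \<in> \<F> \<Longrightarrow> F \<subseteq> F' \<Longrightarrow> F = F'"
    using finite_has_maximal[of \<F>] by auto
  show thesis
  proof
    fix A assume A: "A \<in> \<A>"
    show "\<not> A \<subseteq> G - \<Union>F"
    proof
      assume sub: "A \<subseteq> G - \<Union>F"
      have "insert A F \<in> \<F>"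
        using F(1) A sub by (auto simp: \<F>_def disjoint_def)
      then have "A \<in> F" using F(2) by blast
      with sub have "A = {}" by blast
      with A assms(2) show False by simp
    qed
  qed (use F in \<open>auto simp: \<F>_def\<close>)
qed

text \<open>By Markov's inequality a random \<open>G\<close> has at least \<open>M\<close> elements
  with probability at most 1/2, and \<open>small\<close> keeps the bad events below 1/2 in total.
  Some \<open>G\<close> avoids both; removing the union of a maximal disjoint family from it leaves
  no member of \<open>\<A>\<close>, yet something in every \<open>Y\<close>.\<close>

lemma deletion_method:
  fixes p M :: real
  assumes E: "finite E" "\<And>A. A \<in> \<A> \<Longrightarrow> A \<noteq> {} \<and> A \<subseteq> E \<and> card A \<le> L"
    and S: "finite \<S>" "\<And>Y. Y \<in> \<S> \<Longrightarrow> Y \<subseteq> E"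
    and p: "0 < p" "p < 1" and M: "0 < M" "2 * (p * card E) \<le> M"
    and small: "(\<Sum>Y\<in>\<S>. exp (- p * card Y
       + (\<Sum>A | A \<in> \<A> \<and> A \<inter> Y \<noteq> {}. p ^ card A) / (1 - p) ^ L)) < 1 / 2"
  obtains G where "G \<subseteq> E" "card G < M" "\<And>A. A \<in> \<A> \<Longrightarrow> \<not> A \<subseteq> G" "\<And>Y. Y \<in> \<S> \<Longrightarrow> G \<inter> Y \<noteq> {}"
proof -
  have "\<exists>G \<subseteq> E. card G < M \<and> (\<forall>Y\<in>\<S>. \<not> deletion_bad \<A> Y G)"
  proof (rule ccontr)
    assume "\<not> ?thesis"
    then have *: "M \<le> card G \<or> (\<exists>Y\<in>\<S>. deletion_bad \<A> Y G)" if "G \<subseteq> E" for G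
      using that by (meson not_le)
    have wn: "0 \<le> weight p E G" for G
      using p by (simp add: weight_nonneg)
    have "1 = (\<Sum>G\<in>Pow E. weight p E G)"
      by (simp add: sum_weight E)
    \<comment> \<open>If every \<open>G\<close> failed, its weight would be covered by the Markov
      term (as \<open>card G / M\<close> is at least 1) or by the term of some bad
      \<open>Y\<close>.\<close>
    also have "\<dots> \<le> (\<Sum>G\<in>Pow E. weight p E G * card G / M
        + (\<Sum>Y\<in>\<S>. if deletion_bad \<A> Y G then weight p E G else 0))"
    proof (rule sum_mono)
      fix G assume "G \<in> Pow E"
      then consider "M \<le> card G" | Y where "Y \<in> \<S>" "deletion_bad \<A> Y G"
        using * by blast
      then show "weight p E G \<le> weight p E G * card G / M
        + (\<Sum>Y\<in>\<S>. if deletion_bad \<A> Y G then weight p E G else 0)"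
      proof cases
        case 1
        then have "weight p E G * M \<le> weight p E G * card G"
          by (intro mult_left_mono wn)
        then have "weight p E G \<le> weight p E G * card G / M"
          using M by (simp add: field_simps)
        moreover have "0 \<le> (\<Sum>Y\<in>\<S>. if deletion_bad \<A> Y G then weight p E G else 0)"
          by (intro sum_nonneg) (simp add: wn)
        ultimately show ?thesis by linarith
      next
        case 2
        then have "weight p E G \<le> (\<Sum>Y\<in>\<S>. if deletion_bad \<A> Y G then weight p E G else 0)"
          using member_le_sum[of Y \<S> "\<lambda>Y. if deletion_bad \<A> Y G then weight p E G else 0"] S(1) wn
          by simp
        moreover have "0 \<le> weight p E G * card G / M"
          using M wn by simp
        ultimately show ?thesis by linarith
      qed
    qed
    also have "\<dots> = (\<Sum>G\<in>Pow E. weight p E G * card G) / M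
        + (\<Sum>Y\<in>\<S>. \<Sum>G\<in>Pow E. if deletion_bad \<A> Y G then weight p E G else 0)"
      by (subst sum.swap) (simp add: sum.distrib sum_divide_distrib)
    also have "\<dots> = p * card E / M + (\<Sum>Y\<in>\<S>. \<Sum>G | G \<subseteq> E \<and> deletion_bad \<A> Y G. weight p E G)"
    proof -
      have "(\<Sum>G\<in>Pow E. if deletion_bad \<A> Y G then weight p E G else 0)
          = (\<Sum>G | G \<subseteq> E \<and> deletion_bad \<A> Y G. weight p E G)" for Y
        using E(1) by (subst sum.inter_filter[symmetric]) (auto intro: sum.cong)
      then show ?thesis by (simp add: sum_weight_card E)
    qed
    also have "\<dots> \<le> 1 / 2 + (\<Sum>Y\<in>\<S>. exp (- p * card Y
       + (\<Sum>A | A \<in> \<A> \<and> A \<inter> Y \<noteq> {}. p ^ card A) / (1 - p) ^ L))"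
      using M p E S by (intro add_mono sum_mono weight_deletion_bad_le) (auto simp: field_simps)
    also have "\<dots> < 1" using small by simp
    finally show False by simp
  qed
  then obtain G where G: "G \<subseteq> E" "card G < M" "\<And>Y. Y \<in> \<S> \<Longrightarrow> \<not> deletion_bad \<A> Y G"
    by blast
  have "finite \<A>" using E by (auto intro: finite_subset[of _ "Pow E"])
  moreover have "{} \<notin> \<A>" using E(2) by blast
  ultimately obtain F where F: "F \<subseteq> \<A>" "disjoint F" "\<Union>F \<subseteq> G" "\<And>A. A \<in> \<A> \<Longrightarrow> \<not> A \<subseteq> G - \<Union>F"
    using maximal_disjoint_family by blast
  show thesis
  proof (rule that)
    show "G - \<Union>F \<subseteq> E" using G by auto
    have "card (G - \<Union>F) \<le> card G"
      using finite_subset[OF G(1) E(1)] by (intro card_mono) auto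
    then show "card (G - \<Union>F) < M" using G(2) by linarith
    show "\<not> A \<subseteq> G - \<Union>F" if "A \<in> \<A>" for A using F(4) that .
    show "(G - \<Union>F) \<inter> Y \<noteq> {}" if "Y \<in> \<S>" for Y
    proof
      assume e: "(G - \<Union>F) \<inter> Y = {}"
      \<comment> \<open>Members of \<open>F\<close> that miss \<open>Y\<close> cover nothing of
        \<open>G \<inter> Y\<close>, so restricting \<open>F\<close> to those meeting
        \<open>Y\<close> still covers it.\<close>
      have "deletion_bad \<A> Y G"
        unfolding deletion_bad_def
      proof (intro exI[of _ "{A \<in> F. A \<inter> Y \<noteq> {}}"] conjI)
        show "{A \<in> F. A \<inter> Y \<noteq> {}} \<subseteq> {A \<in> \<A>. A \<inter> Y \<noteq> {}}" using F(1) by auto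
        show "disjoint {A \<in> F. A \<inter> Y \<noteq> {}}" using F(2) by (simp add: disjoint_def)
        show "\<Union>{A \<in> F. A \<inter> Y \<noteq> {}} \<subseteq> G" using F(3) by auto
        show "G \<inter> Y \<subseteq> \<Union>{A \<in> F. A \<inter> Y \<noteq> {}}" using e by auto
      qed
      with G(3) that show False by blast
    qed
  qed
qed

section \<open>Counting the copies of a hypergraph\<close>

text \<open>A copy is kept as its edge set alone, so embeddings that differ by an automorphism give
  one copy. Extensional functions keep the number of embeddings finite.\<close>

definition copies :: "'c set \<Rightarrow> 'a hypergraph \<Rightarrow> 'c set set set" where
  "copies N H = {(`) \<phi> ` edges H | \<phi>. \<phi> \<in> verts H \<rightarrow>\<^sub>E N \<and> inj_on \<phi> (verts H)}"

lemma r_graph_edge: "r_graph r H \<Longrightarrow> d \<in> edges H \<Longrightarrow> d \<subseteq> verts H \<and> card d = r"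
  by (simp add: r_graph_def)

lemma r_graph_finite:
  assumes "r_graph r H"
  shows "finite (verts H)" "finite (edges H)"
  using assms by (auto simp: r_graph_def intro!: finite_subset[of "edges H" "Pow (verts H)"])

lemma card_image_edges:
  assumes "r_graph r H" "inj_on \<phi> (verts H)"
  shows "card ((`) \<phi> ` edges H) = card (edges H)"
proof (rule card_image)
  have "inj_on ((`) \<phi>) (Pow (verts H))"
    using assms(2) by (simp add: inj_on_image_Pow)
  then show "inj_on ((`) \<phi>) (edges H)"
    using r_graph_edge[OF assms(1)] by (auto elim!: inj_on_subset)
qed

lemma copiesE:
  assumes "A \<in> copies N H" "r_graph r H"
  shows "A \<subseteq> {d. d \<subseteq> N \<and> card d = r}" "card A = card (edges H)"
proof -
  obtain \<phi> where \<phi>: "A = (`) \<phi> ` edges H" "\<phi> \<in> verts H \<rightarrow>\<^sub>E N" "inj_on \<phi> (verts H)"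
    using assms(1) by (auto simp: copies_def)
  show "card A = card (edges H)"
    using card_image_edges[OF assms(2) \<phi>(3)] \<phi>(1) by simp
  show "A \<subseteq> {d. d \<subseteq> N \<and> card d = r}"
  proof
    fix a assume "a \<in> A"
    then obtain d where d: "d \<in> edges H" "a = \<phi> ` d" using \<phi>(1) by auto
    have "d \<subseteq> verts H" "card d = r" using r_graph_edge[OF assms(2) d(1)] by auto
    then show "a \<in> {d. d \<subseteq> N \<and> card d = r}"
      using \<phi>(2,3) d(2) by (auto simp: card_image inj_on_subset)
  qed
qed

lemma finite_copies: "finite N \<Longrightarrow> r_graph r H \<Longrightarrow> finite (copies N H)"
  by (rule finite_subset[of "copies N H" "Pow {d. d \<subseteq> N \<and> card d = r}"])
    (blast dest: copiesE(1), simp)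

text \<open>A map of \<open>d\<close> onto the equally large \<open>y\<close> is a bijection, one of
  \<open>fact (card d)\<close>; the vertices outside \<open>d\<close> go anywhere in
  \<open>N\<close>.\<close>

lemma card_maps_onto_le:
  assumes "finite V" "finite N" "d \<subseteq> V" "finite y" "card y = card d"
  shows "card {\<phi> \<in> V \<rightarrow>\<^sub>E N. \<phi> ` d = y} \<le> fact (card d) * card N ^ (card V - card d)"
proof -
  have fd: "finite d" using assms finite_subset by auto
  define T where "T = {f \<in> d \<rightarrow>\<^sub>E y. inj_on f d} \<times> (V - d \<rightarrow>\<^sub>E N)"
  define g where "g \<phi> = (restrict \<phi> d, restrict \<phi> (V - d))" for \<phi> :: "'a \<Rightarrow> 'b"
  have "finite T"
    unfolding T_def using fd assms
    by (intro finite_cartesian_product finite_subset[of "{f \<in> d \<rightarrow>\<^sub>E y. inj_on f d}" "d \<rightarrow>\<^sub>E y"] finite_PiE) auto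
  have "card {\<phi> \<in> V \<rightarrow>\<^sub>E N. \<phi> ` d = y} \<le> card T"
  proof (rule card_inj_on_le[of g])
    show "inj_on g {\<phi> \<in> V \<rightarrow>\<^sub>E N. \<phi> ` d = y}"
    proof (rule inj_onI)
      fix \<phi> \<psi> assume *: "\<phi> \<in> {\<phi> \<in> V \<rightarrow>\<^sub>E N. \<phi> ` d = y}" "\<psi> \<in> {\<phi> \<in> V \<rightarrow>\<^sub>E N. \<phi> ` d = y}" "g \<phi> = g \<psi>"
      show "\<phi> = \<psi>"
      proof (rule PiE_ext)
        show "\<phi> \<in> V \<rightarrow>\<^sub>E N" "\<psi> \<in> V \<rightarrow>\<^sub>E N" using * by auto
        fix i assume "i \<in> V"
        then show "\<phi> i = \<psi> i"
          using *(3) by (cases "i \<in> d") (auto simp: g_def restrict_def fun_eq_iff dest!: spec[of _ i])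
      qed
    qed
    have "inj_on \<phi> d" if "\<phi> ` d = y" for \<phi>
      using that assms(5) fd by (simp add: eq_card_imp_inj_on)
    then show "g ` {\<phi> \<in> V \<rightarrow>\<^sub>E N. \<phi> ` d = y} \<subseteq> T"
      using assms(3) by (fastforce simp: g_def T_def restrict_PiE_iff)
  qed fact
  also have "\<dots> = fact (card d) * card N ^ (card V - card d)"
  proof -
    have "card {f \<in> d \<rightarrow>\<^sub>E y. inj_on f d} = prod ((-) (card d)) {0..<card d}"
      using card_inj_on_subset_funcset[OF fd assms(4) order_refl] assms(5) by simp
    also have "\<dots> = fact (card d)"
      by (simp add: fact_prod_rev)
    finally show ?thesis
      using assms by (simp add: T_def card_cartesian_product card_funcsetE card_Diff_subset fd)
  qed
  finally show ?thesis .
qed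

text \<open>Composing \<open>\<phi>\<close> with an automorphism that stabilises \<open>d\<close>
  changes neither the copy nor the image of \<open>d\<close>. Different automorphisms give different
  embeddings because \<open>\<phi>\<close> is injective and permutations are the identity off the
  vertex set.\<close>

lemma edge_auts_le_card_fibre:
  assumes H: "r_graph r H" and N: "finite N"
    and \<phi>: "\<phi> \<in> verts H \<rightarrow>\<^sub>E N" "inj_on \<phi> (verts H)" and d: "d \<in> edges H"
  shows "edge_auts H d \<le> card {\<psi> \<in> verts H \<rightarrow>\<^sub>E N. inj_on \<psi> (verts H)
    \<and> (`) \<psi> ` edges H = (`) \<phi> ` edges H \<and> \<psi> ` d = \<phi> ` d}"
  unfolding edge_auts_def
proof (rule card_inj_on_le[of "\<lambda>\<sigma>. restrict (\<phi> \<circ> \<sigma>) (verts H)"])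
  let ?V = "verts H"
  let ?St = "{\<sigma>. \<sigma> permutes ?V \<and> (`) \<sigma> ` edges H = edges H \<and> \<sigma> ` d = d}"
  let ?R = "{\<psi> \<in> ?V \<rightarrow>\<^sub>E N. inj_on \<psi> ?V \<and> (`) \<psi> ` edges H = (`) \<phi> ` edges H \<and> \<psi> ` d = \<phi> ` d}"
  show "finite ?R"
    using N r_graph_finite[OF H] by (intro finite_subset[of ?R "?V \<rightarrow>\<^sub>E N"] finite_PiE) auto
  show "inj_on (\<lambda>\<sigma>. restrict (\<phi> \<circ> \<sigma>) ?V) ?St"
  proof (rule inj_onI, rule ext)
    fix \<sigma> \<tau> x assume *: "\<sigma> \<in> ?St" "\<tau> \<in> ?St" "restrict (\<phi> \<circ> \<sigma>) ?V = restrict (\<phi> \<circ> \<tau>) ?V"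
    show "\<sigma> x = \<tau> x"
    proof (cases "x \<in> ?V")
      case True
      then have "\<phi> (\<sigma> x) = \<phi> (\<tau> x)"
        using fun_cong[OF *(3), of x] by simp
      moreover have "\<sigma> x \<in> ?V" "\<tau> x \<in> ?V"
        using * True by (auto simp: permutes_in_image)
      ultimately show ?thesis using \<phi>(2) by (auto dest: inj_onD)
    next
      case False
      then show ?thesis using *(1,2) by (auto simp: permutes_def)
    qed
  qed
  show "(\<lambda>\<sigma>. restrict (\<phi> \<circ> \<sigma>) ?V) ` ?St \<subseteq> ?R"
  proof (rule image_subsetI)
    fix \<sigma> assume "\<sigma> \<in> ?St"
    then have \<sigma>: "\<sigma> permutes ?V" "(`) \<sigma> ` edges H = edges H" "\<sigma> ` d = d" by auto
    have im: "restrict (\<phi> \<circ> \<sigma>) ?V ` c = \<phi> ` \<sigma> ` c" if "c \<in> edges H" for c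
      using r_graph_edge[OF H that] by (auto simp: image_image intro!: image_cong)
    have "(`) (restrict (\<phi> \<circ> \<sigma>) ?V) ` edges H = (`) \<phi> ` (`) \<sigma> ` edges H"
      unfolding image_image[of "(`) \<phi>"] by (rule image_cong[OF refl im])
    moreover have "inj_on (\<phi> \<circ> \<sigma>) ?V"
      using \<phi>(2) \<sigma>(1) by (intro comp_inj_on) (auto simp: permutes_inj_on permutes_image)
    moreover have "\<sigma> x \<in> ?V" if "x \<in> ?V" for x
      using that \<sigma>(1) by (simp add: permutes_in_image)
    ultimately show "restrict (\<phi> \<circ> \<sigma>) ?V \<in> ?R"
      using \<sigma> \<phi>(1) im[OF d] by (auto simp: inj_on_restrict_eq)
  qed
qed

lemma min_edge_auts_pos:
  assumes "r_graph r H" "edges H \<noteq> {}"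
  shows "0 < min_edge_auts H"
proof -
  have "0 < edge_auts H d" for d
  proof -
    let ?St = "{\<sigma>. \<sigma> permutes verts H \<and> (`) \<sigma> ` edges H = edges H \<and> \<sigma> ` d = d}"
    have "finite ?St"
      using finite_permutations[OF r_graph_finite(1)[OF assms(1)]] by (rule rev_finite_subset) auto
    moreover have "id \<in> ?St" by (simp add: permutes_id)
    then have "?St \<noteq> {}" by (metis empty_iff)
    ultimately show ?thesis unfolding edge_auts_def by (intro card_gt_0_iff[THEN iffD2] conjI)
  qed
  then show ?thesis
    using assms r_graph_finite[OF assms(1)] by (simp add: min_edge_auts_def)
qed

text \<open>Pairs of an embedding \<open>\<psi>\<close> and an edge \<open>d\<close> mapped into \<open>Y\<close> are counted twice: composing \<open>\<psi>\<close> with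
  the stabiliser of \<open>d\<close> yields at least \<^term>\<open>min_edge_auts H\<close> pairs for each copy.\<close>

lemma card_copies_meeting_le:
  assumes H: "r_graph r H" and N: "finite N" and Y: "Y \<subseteq> {d. d \<subseteq> N \<and> card d = r}"
  shows "min_edge_auts H * card {A \<in> copies N H. A \<inter> Y \<noteq> {}}
    \<le> card (edges H) * (card Y * (fact r * card N ^ (card (verts H) - r)))"
proof -
  let ?V = "verts H"
  define C where "C = {A \<in> copies N H. A \<inter> Y \<noteq> {}}"
  define P where "P = {(\<psi>, d). \<psi> \<in> ?V \<rightarrow>\<^sub>E N \<and> inj_on \<psi> ?V \<and> d \<in> edges H \<and> \<psi> ` d \<in> Y}"
  define g where "g x = (`) (fst x) ` edges H" for x :: "('a \<Rightarrow> 'b) \<times> 'a set"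
  note fin = r_graph_finite[OF H]
  have finY: "finite Y"
    using Y N by (auto intro: finite_subset[of _ "Pow N"])
  have finC: "finite C"
    using finite_copies[OF N H] by (simp add: C_def)
  have finP: "finite P"
    using N fin by (intro finite_subset[of P "(?V \<rightarrow>\<^sub>E N) \<times> edges H"] finite_cartesian_product finite_PiE)
      (auto simp: P_def)
  have "min_edge_auts H \<le> card {x \<in> P. g x = A}" if "A \<in> C" for A
  proof -
    obtain \<phi> d where \<phi>: "\<phi> \<in> ?V \<rightarrow>\<^sub>E N" "inj_on \<phi> ?V" "A = (`) \<phi> ` edges H"
        and d: "d \<in> edges H" "\<phi> ` d \<in> Y"
      using \<open>A \<in> C\<close> by (auto simp: C_def copies_def)
    let ?R = "{\<psi> \<in> ?V \<rightarrow>\<^sub>E N. inj_on \<psi> ?V \<and> (`) \<psi> ` edges H = (`) \<phi> ` edges H \<and> \<psi> ` d = \<phi> ` d}"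
    have "min_edge_auts H \<le> edge_auts H d"
      using d fin by (simp add: min_edge_auts_def)
    also have "\<dots> \<le> card ?R"
      by (rule edge_auts_le_card_fibre[OF H N \<phi>(1,2) d(1)])
    also have "\<dots> \<le> card {x \<in> P. g x = A}"
    proof (rule card_inj_on_le[of "\<lambda>\<psi>. (\<psi>, d)"])
      show "(\<lambda>\<psi>. (\<psi>, d)) ` ?R \<subseteq> {x \<in> P. g x = A}"
        using d \<phi>(3) by (force simp: P_def g_def)
    qed (use finP in \<open>simp_all add: inj_on_def\<close>)
    finally show ?thesis .
  qed
  then have "min_edge_auts H * card C \<le> (\<Sum>A\<in>C. card {x \<in> P. g x = A})"
    using sum_mono[of C "\<lambda>_. min_edge_auts H" "\<lambda>A. card {x \<in> P. g x = A}"] by (simp add: mult.commute)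
  also have "\<dots> = card P"
  proof -
    have "g ` P \<subseteq> C"
    proof (rule image_subsetI)
      fix x assume "x \<in> P"
      then obtain \<psi> d where "x = (\<psi>, d)" and x: "\<psi> \<in> ?V \<rightarrow>\<^sub>E N" "inj_on \<psi> ?V" "d \<in> edges H" "\<psi> ` d \<in> Y"
        by (auto simp: P_def)
      then have "g x = (`) \<psi> ` edges H" by (simp add: g_def)
      moreover have "(`) \<psi> ` edges H \<in> copies N H" using x unfolding copies_def by blast
      ultimately show "g x \<in> C" using x by (auto simp: C_def)
    qed
    from sum.group[OF finP finC this, of "\<lambda>_. 1::nat"] show ?thesis by simp
  qed
  finally have le1: "min_edge_auts H * card C \<le> card P" .
  have finM: "finite {\<psi> \<in> ?V \<rightarrow>\<^sub>E N. \<psi> ` d = y}" for d y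
    using finite_PiE[OF fin(1), of "\<lambda>_. N"] N by simp
  \<comment> \<open>For the upper count, \<open>d\<close> and its image \<open>y\<close> are fixed
    and injectivity of \<open>\<psi>\<close> is forgotten.\<close>
  have "card P \<le> card (\<Union>d\<in>edges H. \<Union>y\<in>Y. {\<psi> \<in> ?V \<rightarrow>\<^sub>E N. \<psi> ` d = y} \<times> {d})"
  proof (rule card_mono)
    show "finite (\<Union>d\<in>edges H. \<Union>y\<in>Y. {\<psi> \<in> ?V \<rightarrow>\<^sub>E N. \<psi> ` d = y} \<times> {d})"
      using fin(2) finY finM by simp
    show "P \<subseteq> (\<Union>d\<in>edges H. \<Union>y\<in>Y. {\<psi> \<in> ?V \<rightarrow>\<^sub>E N. \<psi> ` d = y} \<times> {d})"
      by (auto simp: P_def)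
  qed
  also have "\<dots> \<le> (\<Sum>d\<in>edges H. card (\<Union>y\<in>Y. {\<psi> \<in> ?V \<rightarrow>\<^sub>E N. \<psi> ` d = y} \<times> {d}))"
    by (rule card_UN_le[OF fin(2)])
  also have "\<dots> \<le> (\<Sum>d\<in>edges H. \<Sum>y\<in>Y. card ({\<psi> \<in> ?V \<rightarrow>\<^sub>E N. \<psi> ` d = y} \<times> {d}))"
    by (intro sum_mono card_UN_le[OF finY])
  also have "\<dots> \<le> (\<Sum>d\<in>edges H. \<Sum>y\<in>Y. fact r * card N ^ (card ?V - r))"
  proof (intro sum_mono)
    fix d y assume d: "d \<in> edges H" and y: "y \<in> Y"
    have "y \<subseteq> N" "card y = card d"
      using Y y r_graph_edge[OF H d] by auto
    moreover from this N have "finite y" by (simp add: finite_subset)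
    ultimately show "card ({\<psi> \<in> ?V \<rightarrow>\<^sub>E N. \<psi> ` d = y} \<times> {d}) \<le> fact r * card N ^ (card ?V - r)"
      using card_maps_onto_le[OF fin(1) N, of d y] r_graph_edge[OF H d] by (simp add: card_cartesian_product)
  qed
  also have "\<dots> = card (edges H) * (card Y * (fact r * card N ^ (card ?V - r)))"
    by simp
  finally show ?thesis using le1 by (simp add: C_def)
qed

section \<open>Colour classes, the chromatic number and freeness\<close>

text \<open>Pigeonhole: at most \<open>k\<close> classes of at most \<open>t - 1\<close> vertices
  cannot cover \<open>k * t\<close> vertices. The class is trimmed to size exactly \<open>t\<close>,
  so that a union bound over \<open>t\<close>-sets suffices.\<close>

lemma large_colour_class:
  fixes c :: "nat \<Rightarrow> nat"
  assumes "c ` {..<k * t} \<subseteq> {..<j}" "j \<le> k" "0 < k" "0 < t"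
  obtains S i where "S \<subseteq> {..<k * t}" "card S = t" "\<And>v. v \<in> S \<Longrightarrow> c v = i"
proof -
  have "\<exists>i<j. t \<le> card {v \<in> {..<k * t}. c v = i}"
  proof (rule ccontr)
    assume "\<not> ?thesis"
    then have small: "card {v \<in> {..<k * t}. c v = i} \<le> t - 1" if "i < j" for i
      using that by force
    have "k * t = (\<Sum>i<j. card {v \<in> {..<k * t}. c v = i})"
      using sum.group[of "{..<k * t}" "{..<j}" c "\<lambda>_. 1::nat"] assms(1) by simp
    also have "\<dots> \<le> (\<Sum>i<j. t - 1)"
      using small by (intro sum_mono) simp
    also have "\<dots> \<le> k * (t - 1)"
      using assms(2) by simp
    also have "\<dots> < k * t" using assms(3,4) by simp
    finally show False by simp
  qed
  then obtain i where "t \<le> card {v \<in> {..<k * t}. c v = i}" by blast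
  then obtain S where "S \<subseteq> {v \<in> {..<k * t}. c v = i}" "card S = t"
    using obtain_subset_with_card_n by metis
  then show thesis using that[of S i] by blast
qed

text \<open>A colour class contains a \<open>t\<close>-set, whose edge is monochromatic. All
  \<open>j \<le> k\<close> are excluded, which bounds the infimum below by
  \<open>Suc k\<close>.\<close>

lemma chromatic_number_gt:
  assumes "0 < k" "0 < t"
    and "\<And>S. S \<subseteq> {..<k * t} \<Longrightarrow> card S = t \<Longrightarrow> \<exists>d\<in>G. d \<subseteq> S"
  shows "enat k < chromatic_number (Hypergraph {..<k * t} G)"
proof -
  have "\<not> colorable j (Hypergraph {..<k * t} G)" if j: "j \<le> k" for j
  proof
    assume "colorable j (Hypergraph {..<k * t} G)"
    then obtain c where c: "c ` {..<k * t} \<subseteq> {..<j}" "\<And>d. d \<in> G \<Longrightarrow> \<not> (\<exists>i. \<forall>v\<in>d. c v = i)"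
      by (auto simp: colorable_def)
    obtain S i where S: "S \<subseteq> {..<k * t}" "card S = t" "\<And>v. v \<in> S \<Longrightarrow> c v = i"
      using large_colour_class[OF c(1) j assms(1,2)] by blast
    obtain d where "d \<in> G" "d \<subseteq> S" using assms(3) S by blast
    with c(2) S(3) show False by blast
  qed
  then have "enat (Suc k) \<le> chromatic_number (Hypergraph {..<k * t} G)"
    unfolding chromatic_number_def by (intro Inf_greatest) (auto simp: not_less_eq_eq[symmetric])
  then show ?thesis
    using less_le_trans[of "enat k" "enat (Suc k)"] by simp
qed

lemma free_ofI:
  assumes "\<And>H. H \<in> \<H> \<Longrightarrow> \<exists>r. r_graph r H"
    and "\<And>H A. H \<in> \<H> \<Longrightarrow> A \<in> copies N H \<Longrightarrow> \<not> A \<subseteq> G"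
  shows "free_of \<H> (Hypergraph N G)"
  unfolding free_of_def
proof safe
  fix H G' assume H: "H \<in> \<H>" and G': "subhypergraph G' (Hypergraph N G)" and "isomorphic H G'"
  then obtain f where f: "bij_betw f (verts H) (verts G')" "(`) f ` edges H = edges G'"
    by (auto simp: isomorphic_def)
  obtain r where r: "r_graph r H" using assms(1)[OF H] by blast
  \<comment> \<open>An isomorphism is arbitrary off the vertex set; restricting it gives the
    extensional map that \<open>copies\<close> asks for.\<close>
  define \<phi> where "\<phi> = restrict f (verts H)"
  have "\<phi> ` d = f ` d" if "d \<in> edges H" for d
    using r_graph_edge[OF r that] by (auto simp: \<phi>_def intro!: image_cong)
  then have "edges G' = (`) \<phi> ` edges H"
    using f(2) by (metis image_cong)
  moreover have "\<phi> \<in> verts H \<rightarrow>\<^sub>E N"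
    using bij_betw_imp_surj_on[OF f(1)] G' by (auto simp: \<phi>_def subhypergraph_def)
  moreover have "inj_on \<phi> (verts H)"
    using bij_betw_imp_inj_on[OF f(1)] by (simp add: \<phi>_def inj_on_restrict_eq)
  ultimately have "edges G' \<in> copies N H"
    by (auto simp: copies_def)
  with assms(2)[OF H] G' show False
    by (auto simp: subhypergraph_def)
qed

section \<open>Numerical conditions that bound the minimum number of edges\<close>

text \<open>The deletion method is applied to the \<open>r\<close>-subsets of \<open>k * t\<close>
  points, with one \<open>Y\<close> for each \<open>t\<close>-set \<open>S\<close>: the
  \<open>r\<close>-subsets of \<open>S\<close>. The number \<open>q\<close> bounds the expected
  number of copies through one fixed \<open>r\<close>-set, so \<open>(t choose r) * q\<close> bounds
  it for copies meeting \<open>Y\<close>.\<close>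

lemma min_edges_less:
  fixes H :: "nat \<Rightarrow> 'a hypergraph" and p q M :: real
  assumes H: "\<And>i. i \<in> I \<Longrightarrow> r_graph r (H i) \<and> edges (H i) \<noteq> {} \<and> card (edges (H i)) \<le> L"
    and I: "finite I" and p: "0 < p" "p < 1" and kt: "0 < k" "0 < t"
    and M: "0 < M" "2 * (p * ((k * t) choose r)) \<le> M"
    and q: "(\<Sum>i\<in>I. card (edges (H i)) * fact r * real (k * t) ^ (card (verts (H i)) - r)
        * p ^ card (edges (H i)) / min_edge_auts (H i)) = q"
    and small: "((k * t) choose t) * exp (- p * (t choose r) + (t choose r) * q / (1 - p) ^ L) < 1 / 2"
  shows "ereal_of_enat (min_edges r k (H ` I)) < ereal M"
proof -
  define N where "N = {..<k * t}"
  define E where "E = {d. d \<subseteq> N \<and> card d = r}"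
  define \<A> where "\<A> = (\<Union>i\<in>I. copies N (H i))"
  define E' where "E' S = {d. d \<subseteq> S \<and> card d = r}" for S :: "nat set"
  define \<T> where "\<T> = {S. S \<subseteq> N \<and> card S = t}"
  have finN: "finite N" and cardN: "card N = k * t" by (simp_all add: N_def)
  have finE: "finite E" using finN by (simp add: E_def)
  have cardE: "card E = (k * t) choose r" using n_subsets[OF finN] by (simp add: E_def cardN)
  have fin\<T>: "finite \<T>" using finN by (simp add: \<T>_def)
  have card\<T>: "card \<T> = (k * t) choose t" using n_subsets[OF finN] by (simp add: \<T>_def cardN)
  have E': "E' S \<subseteq> E" "card (E' S) = t choose r" if "S \<in> \<T>" for S
    using that n_subsets[of S r] finite_subset[OF _ finN] by (auto simp: \<T>_def E'_def E_def)
  have \<A>: "A \<noteq> {} \<and> A \<subseteq> E \<and> card A \<le> L" if A: "A \<in> \<A>" for A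
  proof -
    obtain i where i: "i \<in> I" "A \<in> copies N (H i)" using A by (auto simp: \<A>_def)
    with H have r: "r_graph r (H i)" by blast
    have "card A = card (edges (H i))" "A \<subseteq> E"
      using copiesE[OF i(2) r] by (auto simp: E_def)
    moreover have "0 < card (edges (H i))"
      using H[OF i(1)] r_graph_finite(2)[OF r] by (simp add: card_gt_0_iff)
    ultimately show ?thesis using H[OF i(1)] by auto
  qed
  have copies_sum: "(\<Sum>A | A \<in> \<A> \<and> A \<inter> Y \<noteq> {}. p ^ card A) \<le> (t choose r) * q"
    if Y: "Y \<subseteq> E" "card Y = t choose r" for Y
  proof -
    have "(\<Sum>A | A \<in> \<A> \<and> A \<inter> Y \<noteq> {}. p ^ card A)
        = (\<Sum>A\<in>(\<Union>i\<in>I. {A \<in> copies N (H i). A \<inter> Y \<noteq> {}}). p ^ card A)"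
      by (rule sum.cong) (auto simp: \<A>_def)
    also have "\<dots> \<le> (\<Sum>i\<in>I. \<Sum>A | A \<in> copies N (H i) \<and> A \<inter> Y \<noteq> {}. p ^ card A)"
    proof (rule sum_UN_le[OF I])
      show "finite {A \<in> copies N (H i). A \<inter> Y \<noteq> {}}" if "i \<in> I" for i
        using finite_copies[OF finN, of r "H i"] H[OF that] by simp
    qed (use p in simp)
    also have "\<dots> \<le> (\<Sum>i\<in>I. (t choose r) * (card (edges (H i)) * fact r
        * real (k * t) ^ (card (verts (H i)) - r) * p ^ card (edges (H i)) / min_edge_auts (H i)))"
    proof (rule sum_mono)
      fix i assume "i \<in> I"
      note Hi = H[OF this]
      let ?C = "{A \<in> copies N (H i). A \<inter> Y \<noteq> {}}"
      let ?e = "card (edges (H i))" and ?v = "card (verts (H i))" and ?a = "min_edge_auts (H i)"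
      have pos: "0 < ?a" using Hi min_edge_auts_pos by blast
      have "real (?a * card ?C) \<le> real (?e * (card Y * (fact r * card N ^ (?v - r))))"
        unfolding of_nat_le_iff using Hi finN Y(1) by (intro card_copies_meeting_le) (auto simp: E_def)
      then have le: "card ?C \<le> (t choose r) * (?e * fact r * real (k * t) ^ (?v - r)) / ?a"
        using pos Y(2) by (simp add: field_simps cardN)
      have "(\<Sum>A\<in>?C. p ^ card A) = (\<Sum>A\<in>?C. p ^ ?e)"
        using copiesE(2)[of _ N "H i" r] Hi by (intro sum.cong) auto
      also have "\<dots> = card ?C * p ^ ?e" by simp
      also have "\<dots> \<le> (t choose r) * (?e * fact r * real (k * t) ^ (?v - r)) / ?a * p ^ ?e"
        using p by (intro mult_right_mono le) auto
      finally show "(\<Sum>A | A \<in> copies N (H i) \<and> A \<inter> Y \<noteq> {}. p ^ card A)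
          \<le> (t choose r) * (?e * fact r * real (k * t) ^ (?v - r) * p ^ ?e / ?a)"
        by (simp add: mult_ac)
    qed
    also have "\<dots> = (t choose r) * q"
      by (simp add: q[symmetric] sum_distrib_left)
    finally show ?thesis .
  qed
  have "(\<Sum>Y\<in>E' ` \<T>. exp (- p * card Y + (\<Sum>A | A \<in> \<A> \<and> A \<inter> Y \<noteq> {}. p ^ card A) / (1 - p) ^ L))
      \<le> (\<Sum>Y\<in>E' ` \<T>. exp (- p * (t choose r) + (t choose r) * q / (1 - p) ^ L))"
  proof (rule sum_mono)
    fix Y assume "Y \<in> E' ` \<T>"
    then have "Y \<subseteq> E" "card Y = t choose r" using E' by auto
    with copies_sum[OF this] p
    show "exp (- p * card Y + (\<Sum>A | A \<in> \<A> \<and> A \<inter> Y \<noteq> {}. p ^ card A) / (1 - p) ^ L)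
      \<le> exp (- p * (t choose r) + (t choose r) * q / (1 - p) ^ L)"
      by (simp add: divide_right_mono)
  qed
  also have "\<dots> \<le> ((k * t) choose t) * exp (- p * (t choose r) + (t choose r) * q / (1 - p) ^ L)"
    using card_image_le[OF fin\<T>, of E'] card\<T> by (simp add: mult_right_mono)
  also have "\<dots> < 1 / 2" by (rule small)
  finally have bad: "(\<Sum>Y\<in>E' ` \<T>. exp (- p * card Y
      + (\<Sum>A | A \<in> \<A> \<and> A \<inter> Y \<noteq> {}. p ^ card A) / (1 - p) ^ L)) < 1 / 2" .
  have ex: "2 * (p * card E) \<le> M" using M by (simp add: cardE)
  have sub: "Y \<subseteq> E" if "Y \<in> E' ` \<T>" for Y using that E' by auto
  obtain G where G: "G \<subseteq> E" "card G < M" "\<And>A. A \<in> \<A> \<Longrightarrow> \<not> A \<subseteq> G"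
      "\<And>Y. Y \<in> E' ` \<T> \<Longrightarrow> G \<inter> Y \<noteq> {}"
    using deletion_method[OF finE \<A> finite_imageI[OF fin\<T>, of E'] sub p M(1) ex bad] by blast
  have "r_graph r (Hypergraph N G)"
    using G(1) finN by (auto simp: r_graph_def E_def)
  moreover have "free_of (H ` I) (Hypergraph N G)"
    using H G(3) by (intro free_ofI) (auto simp: \<A>_def)
  moreover have "\<exists>d\<in>G. d \<subseteq> S" if "S \<subseteq> {..<k * t}" "card S = t" for S
    using G(4)[of "E' S"] that by (auto simp: \<T>_def N_def E'_def)
  then have "enat k < chromatic_number (Hypergraph N G)"
    unfolding N_def by (rule chromatic_number_gt[OF kt])
  ultimately have "min_edges r k (H ` I) \<le> enat (card (edges (Hypergraph N G)))"
    unfolding min_edges_def by (intro Inf_lower) blast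
  then have "ereal_of_enat (min_edges r k (H ` I)) \<le> ereal (card G)"
    using ereal_of_enat_le_iff[of "min_edges r k (H ` I)" "enat (card G)"] by simp
  also have "\<dots> < ereal M" using G(2) by simp
  finally show ?thesis .
qed

section \<open>The equation defining \<open>c1\<close>, and binomial estimates\<close>

text \<open>The sum is continuous and strictly increasing on the nonnegative reals and vanishes at
  0, since all exponents are positive. This makes the definite description of \<open>c1\<close>
  meaningful.\<close>

lemma ex1_positive_root:
  fixes a :: "'i \<Rightarrow> real" and m :: "'i \<Rightarrow> nat"
  assumes "finite I" "I \<noteq> {}" "\<And>i. i \<in> I \<Longrightarrow> 0 < a i" "\<And>i. i \<in> I \<Longrightarrow> 1 \<le> m i" "0 < b"
  shows "\<exists>!x. 0 < x \<and> (\<Sum>i\<in>I. a i * x ^ m i) = b"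
proof -
  define f where "f x = (\<Sum>i\<in>I. a i * x ^ m i)" for x
  have mono: "f x < f y" if "0 \<le> x" "x < y" for x y
    unfolding f_def using assms that
    by (intro sum_strict_mono mult_strict_left_mono power_strict_mono) (auto simp: Suc_le_eq)
  obtain j where j: "j \<in> I" using assms(2) by blast
  \<comment> \<open>At this point the single summand \<open>j\<close> already reaches
    \<open>b\<close>; the maximum with 1 ensures \<open>z \<le> z ^ m j\<close>.\<close>
  define z where "z = max 1 (b / a j)"
  have "b \<le> a j * z"
    using assms(3)[OF j] by (simp add: z_def field_simps max_def)
  also have "\<dots> \<le> a j * z ^ m j"
    using assms(3)[OF j] assms(4)[OF j] by (intro mult_left_mono self_le_power) (auto simp: z_def)
  also have "\<dots> \<le> f z"
    unfolding f_def using assms(1,3) j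
    by (intro member_le_sum) (auto simp: z_def intro!: mult_nonneg_nonneg less_imp_le)
  finally have "b \<le> f z" .
  moreover have "f 0 = 0"
    unfolding f_def using assms(4) by (intro sum.neutral) (force simp: power_0_left)
  moreover have "continuous_on {0..z} f"
    unfolding f_def by (intro continuous_intros)
  ultimately obtain x where x: "0 \<le> x" "x \<le> z" "f x = b"
    using IVT'[of f 0 b z] assms(5) by (force simp: z_def)
  have "x \<noteq> 0" using x \<open>f 0 = 0\<close> assms(5) by auto
  then have "\<exists>!x. 0 < x \<and> f x = b"
    using x mono by (intro ex1I[of _ x]) (auto, metis less_le not_le_imp_less order_less_irrefl)
  then show ?thesis by (simp add: f_def)
qed

text \<open>The left side divided by \<open>fact t\<close> is one term of the exponential series at
  \<open>t\<close>.\<close>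

lemma power_le_exp_fact: "real t ^ t \<le> exp (real t) * fact t"
proof -
  have "real t ^ t / fact t \<le> (\<Sum>n. real t ^ n / fact n)"
    using sum_le_suminf[of "\<lambda>n. real t ^ n / fact n" "{t}"] summable_exp[of "real t"]
    by (simp add: field_simps)
  also have "\<dots> = exp (real t)" by (simp add: exp_def field_simps)
  finally show ?thesis by (simp add: field_simps)
qed

lemma binomial_le_exp:
  assumes "0 < k" "0 < t"
  shows "real ((k * t) choose t) \<le> exp (t * (1 + ln (real k)))"
proof -
  have "real ((k * t) choose t) * fact t \<le> real (k * t) ^ t"
    using binomial_fact_pow[of "k * t" t] by (metis of_nat_fact of_nat_le_iff of_nat_mult of_nat_power)
  also have "\<dots> = real k ^ t * real t ^ t"
    by (simp add: power_mult_distrib)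
  also have "\<dots> \<le> real k ^ t * (exp (real t) * fact t)"
    by (intro mult_left_mono power_le_exp_fact) simp
  finally have "real ((k * t) choose t) \<le> real k ^ t * exp (real t)"
    by (simp add: field_simps)
  also have "real k ^ t = exp (t * ln (real k))"
    using assms by (simp add: exp_of_nat_mult)
  finally show ?thesis by (simp add: distrib_left exp_add mult.commute)
qed

lemma binomial_le_pow_fact: "real (n choose r) \<le> real n ^ r / fact r"
proof -
  have "real (n choose r) * fact r \<le> real n ^ r"
    using binomial_fact_pow[of n r] by (metis of_nat_fact of_nat_le_iff of_nat_mult of_nat_power)
  then show ?thesis by (simp add: field_simps)
qed

lemma binomial_asymptotic: "(\<lambda>t. real (t choose r) * fact r / real t ^ r) \<longlonglongrightarrow> 1"
proof -
  have "(\<lambda>t. \<Prod>i = 0..<r. (real t - real i) / real t) \<longlonglongrightarrow> (\<Prod>i = 0..<r. 1)"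
    by (intro tendsto_prod) real_asymp
  moreover have "real (t choose r) * fact r / real t ^ r = (\<Prod>i = 0..<r. (real t - real i) / real t)" for t
    by (simp add: binomial_gbinomial gbinomial_prod_rev prod_dividef)
  ultimately show ?thesis by simp
qed

section \<open>Choice of the parameters and asymptotics\<close>

text \<open>The 4 in \<open>t_large\<close> is the 2 wanted in \<open>2 * t * ln k\<close> times the
  2 lost in \<open>t_choose\<close>. The copies cost at most a tenth of
  \<open>p * (t choose r)\<close>, leaving 9/5 of \<open>t * ln k\<close> against the
  \<open>t * (1 + ln k)\<close> from the choice of \<open>S\<close>.\<close>

lemma min_edges_less_at:
  fixes H :: "nat \<Rightarrow> 'a hypergraph" and a c p D :: real
  assumes H: "\<And>i. i \<in> I \<Longrightarrow> r_graph r (H i) \<and> edges (H i) \<noteq> {} \<and> card (edges (H i)) \<le> L"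
    and I: "finite I" and kt: "0 < t" "5 \<le> ln (real k)" and c: "0 < c"
    and D: "D = real r - 1 - a"
    and p: "p = c * real (k * t) powr (- a)" "p < 1"
    and q: "(\<Sum>i\<in>I. card (edges (H i)) * fact r * real (k * t) ^ (card (verts (H i)) - r)
        * p ^ card (edges (H i)) / min_edge_auts (H i)) / (1 - p) ^ L \<le> p / 10"
    and t_choose: "real t ^ r / (2 * fact r) \<le> real (t choose r)"
    and t_large: "4 * fact r / c * (real k powr a * ln (real k)) \<le> real t powr D"
  shows "ereal_of_enat (min_edges r k (H ` I)) < ereal (2 * c * real (k * t) powr (real r - a) / fact r)"
proof -
  \<comment> \<open>Here \<open>k = 0\<close> is excluded by the convention
    \<open>ln 0 = 0\<close>.\<close>
  have k: "0 < k" using kt(2) by (intro Nat.gr0I) simp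
  have kt0: "0 < real (k * t)" using k kt(1) by simp
  have p0: "0 < p" unfolding p(1) using c kt0 by (intro mult_pos_pos) (simp_all only: powr_gt_zero)
  define C where "C = real (t choose r)"
  have "2 * real t * ln (real k)
      = c * real k powr (- a) / (2 * fact r) * real t * (4 * fact r / c * (real k powr a * ln (real k)))"
    using c k by (simp add: powr_minus field_simps)
  also have "\<dots> \<le> c * real k powr (- a) / (2 * fact r) * real t * real t powr D"
    using c by (intro mult_left_mono t_large) auto
  also have "\<dots> = c * real k powr (- a) * (real t powr (1 + D) / (2 * fact r))"
    using kt(1) by (simp add: powr_add)
  also have "real t powr (1 + D) = real t powr (- a) * real t ^ r"
    using kt(1) by (simp add: D powr_realpow[symmetric] powr_add[symmetric])
  also have "c * real k powr (- a) * (real t powr (- a) * real t ^ r / (2 * fact r)) = p * (real t ^ r / (2 * fact r))"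
    using c k kt(1) by (simp add: p powr_mult mult.assoc)
  also have "\<dots> \<le> p * C"
    unfolding C_def using p0 by (intro mult_left_mono t_choose) auto
  finally have pC: "2 * real t * ln (real k) \<le> p * C" .
  define q where "q = (\<Sum>i\<in>I. card (edges (H i)) * fact r * real (k * t) ^ (card (verts (H i)) - r)
        * p ^ card (edges (H i)) / min_edge_auts (H i))"
  have "C * (q / (1 - p) ^ L) \<le> (p * C) / 10"
    using mult_left_mono[OF q, of C] unfolding q_def[symmetric] by (simp add: C_def mult.commute)
  then have expo: "- p * C + C * q / (1 - p) ^ L \<le> - (9 / 10) * (2 * real t * ln (real k))"
    using pC unfolding times_divide_eq_right by linarith
  have "((k * t) choose t) * exp (- p * C + C * q / (1 - p) ^ L)
      \<le> exp (t * (1 + ln (real k))) * exp (- (9 / 10) * (2 * real t * ln (real k)))"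
    using binomial_le_exp[OF k kt(1)] expo by (intro mult_mono) auto
  also have "\<dots> = exp (real t * (1 - 4 / 5 * ln (real k)))"
    by (simp add: exp_add[symmetric] algebra_simps)
  \<comment> \<open>From \<open>5 \<le> ln k\<close>, the bracket is at most 1 - 4 = -3.\<close>
  also have "\<dots> \<le> exp (1 * (- 3))"
  proof -
    have "real t * (1 - 4 / 5 * ln (real k)) \<le> real t * (- 3)"
      using kt by (intro mult_left_mono) auto
    also have "\<dots> \<le> 1 * (- 3)"
      using kt(1) by simp
    finally show ?thesis by simp
  qed
  also have "\<dots> < 1 / (2 :: real)"
    using exp_ge_add_one_self[of "3::real"] by (simp add: exp_minus field_simps)
  finally have small: "((k * t) choose t) * exp (- p * C + C * q / (1 - p) ^ L) < 1 / 2" .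
  have "p * ((k * t) choose r) \<le> p * (real (k * t) ^ r / fact r)"
    using p0 by (intro mult_left_mono binomial_le_pow_fact) auto
  also have "\<dots> = c * (real (k * t) powr (- a) * real (k * t) powr real r) / fact r"
    using kt0 unfolding powr_realpow[OF kt0] by (simp add: p)
  also have "\<dots> = c * real (k * t) powr (real r - a) / fact r"
    by (simp only: powr_add[symmetric]) simp
  finally have "2 * (p * ((k * t) choose r)) \<le> 2 * c * real (k * t) powr (real r - a) / fact r"
    by simp
  moreover have "0 < 2 * c * real (k * t) powr (real r - a) / fact r"
    using c kt0 by (intro divide_pos_pos mult_pos_pos) (simp_all only: powr_gt_zero, simp_all)
  ultimately show ?thesis
    using min_edges_less[OF H I p0 p(2) k kt(1) _ _ q_def[symmetric]] small unfolding C_def by blast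
qed

text \<open>After division by the edge probability, the \<open>i\<close>-th term is a constant times
  \<open>x powr \<beta> i\<close>. The exponent is 0 on \<open>J\<close> and negative elsewhere, so
  only \<open>J\<close> survives, while \<open>(1 - p) ^ L\<close> tends to 1.\<close>

lemma copy_weight_tendsto:
  fixes a c :: real and e v \<alpha> :: "'i \<Rightarrow> nat"
  assumes I: "finite I" "J \<subseteq> I" and c: "0 < c" and a: "0 < a"
    and e: "\<And>i. i \<in> I \<Longrightarrow> 1 \<le> e i \<and> r \<le> v i"
    and J: "\<And>i. i \<in> J \<Longrightarrow> a * (real (e i) - 1) = real (v i) - real r"
    and nJ: "\<And>i. i \<in> I - J \<Longrightarrow> real (v i) - real r < a * (real (e i) - 1)"
  shows "((\<lambda>x. (\<Sum>i\<in>I. real (e i) * fact r * x ^ (v i - r) * (c * x powr (- a)) ^ e i / \<alpha> i)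
      / (c * x powr (- a)) / (1 - c * x powr (- a)) ^ L)
    \<longlongrightarrow> (\<Sum>i\<in>J. real (e i) * fact r * c ^ (e i - 1) / \<alpha> i)) at_top"
proof -
  define h where "h x = c * x powr (- a)" for x
  define w where "w i = real (e i) * fact r * c ^ (e i - 1) / \<alpha> i" for i
  define \<beta> where "\<beta> i = real (v i) - real r - a * (real (e i) - 1)" for i
  have h0: "(h \<longlongrightarrow> 0) at_top"
    unfolding h_def using a c by real_asymp
  have term_eq: "real (e i) * fact r * x ^ (v i - r) * h x ^ e i / \<alpha> i / h x = w i * x powr \<beta> i"
    if i: "i \<in> I" and x: "0 < x" for i and x :: real
  proof -
    have hx: "h x \<noteq> 0" using c x by (simp add: h_def)
    have "h x ^ e i = h x * h x ^ (e i - 1)"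
      using e[OF i] by (simp add: power_eq_if)
    then have "real (e i) * fact r * x ^ (v i - r) * h x ^ e i / \<alpha> i / h x
        = real (e i) * fact r * x ^ (v i - r) * h x ^ (e i - 1) / \<alpha> i"
      using hx by simp
    also have "\<dots> = w i * (x powr (real (v i) - real r) * x powr (- a * (real (e i) - 1)))"
    proof -
      have "h x ^ (e i - 1) = c ^ (e i - 1) * x powr (- a * (real (e i) - 1))"
        using e[OF i] x by (simp add: h_def power_mult_distrib powr_powr of_nat_diff flip: powr_realpow)
      moreover have "x ^ (v i - r) = x powr (real (v i) - real r)"
        using e[OF i] x by (simp add: of_nat_diff flip: powr_realpow)
      ultimately show ?thesis by (simp add: w_def)
    qed
    also have "\<dots> = w i * x powr \<beta> i"
      by (simp add: \<beta>_def powr_add[symmetric])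
    finally show ?thesis .
  qed
  have "((\<lambda>x. \<Sum>i\<in>I. w i * x powr \<beta> i) \<longlongrightarrow> (\<Sum>i\<in>I. if i \<in> J then w i else 0)) at_top"
  proof (rule tendsto_sum)
    fix i assume i: "i \<in> I"
    show "((\<lambda>x. w i * x powr \<beta> i) \<longlongrightarrow> (if i \<in> J then w i else 0)) at_top"
    proof (cases "i \<in> J")
      case True
      then have "\<beta> i = 0" using J by (simp add: \<beta>_def)
      moreover have "((\<lambda>x::real. w i * x powr 0) \<longlongrightarrow> w i) at_top"
        by real_asymp
      ultimately show ?thesis using True by simp
    next
      case False
      then have "\<beta> i < 0" using nJ[of i] i by (simp add: \<beta>_def)
      then have "((\<lambda>x. w i * x powr \<beta> i) \<longlongrightarrow> w i * 0) at_top"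
        by (intro tendsto_mult tendsto_const tendsto_neg_powr filterlim_ident)
      then show ?thesis using False by simp
    qed
  qed
  also have "(\<Sum>i\<in>I. if i \<in> J then w i else 0) = (\<Sum>i\<in>J. w i)"
    using I by (simp add: sum.inter_restrict[symmetric] Int_absorb1)
  finally have "((\<lambda>x. (\<Sum>i\<in>I. w i * x powr \<beta> i) / (1 - h x) ^ L) \<longlongrightarrow> (\<Sum>i\<in>J. w i) / (1 - 0) ^ L) at_top"
    by (intro tendsto_intros h0) auto
  moreover have "eventually (\<lambda>x. (\<Sum>i\<in>I. w i * x powr \<beta> i) / (1 - h x) ^ L
      = (\<Sum>i\<in>I. real (e i) * fact r * x ^ (v i - r) * h x ^ e i / \<alpha> i) / h x / (1 - h x) ^ L) at_top"
    using eventually_gt_at_top[of 0]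
  proof eventually_elim
    case (elim x)
    then show ?case
      unfolding sum_divide_distrib[of _ I "h x"] by (simp only: term_eq cong: sum.cong)
  qed
  ultimately have "((\<lambda>x. (\<Sum>i\<in>I. real (e i) * fact r * x ^ (v i - r) * h x ^ e i / \<alpha> i) / h x / (1 - h x) ^ L)
      \<longlongrightarrow> (\<Sum>i\<in>J. w i)) at_top"
    using tendsto_cong by force
  then show ?thesis by (simp add: h_def w_def)
qed

lemma eventually_min_edges_less:
  fixes H :: "nat \<Rightarrow> 'a hypergraph" and a c D :: real
  defines "e \<equiv> \<lambda>i. card (edges (H i))" and "v \<equiv> \<lambda>i. card (verts (H i))"
  assumes H: "\<And>i. i \<in> I \<Longrightarrow> r_graph r (H i)"
    and I: "finite I" "J \<subseteq> I" and c: "0 < c" and a: "0 < a" and D: "D = real r - 1 - a" "0 < D"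
    and e: "\<And>i. i \<in> I \<Longrightarrow> 1 \<le> e i \<and> r \<le> v i"
    and J: "\<And>i. i \<in> J \<Longrightarrow> a * (real (e i) - 1) = real (v i) - real r"
    and nJ: "\<And>i. i \<in> I - J \<Longrightarrow> real (v i) - real r < a * (real (e i) - 1)"
    and root: "(\<Sum>i\<in>J. real (e i) * c ^ (e i - 1) / min_edge_auts (H i)) = 1 / (50 * fact r)"
  shows "\<forall>\<^sub>F k in sequentially. ereal_of_enat (min_edges r k (H ` I))
    < ereal (2 * (fact r / c) powr (1 / D) * 8 powr ((real r - a) / D)
        * (real k ^ (r - 1) * ln (real k)) powr ((real r - a) / D))"
proof -
  define L where "L = (\<Sum>i\<in>I. e i)"
  \<comment> \<open>Twice the constant \<open>4 * fact r / c\<close> that is needed; the spare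
    factor 2 pays for rounding \<open>T k\<close> down to the integer \<open>t k\<close>.\<close>
  define B where "B = 8 * fact r / c"
  have B: "0 < B" using c by (simp add: B_def)
  define T where "T k = (B * (real k powr a * ln (real k))) powr (1 / D)" for k
  define t where "t k = nat \<lfloor>T k\<rfloor>" for k
  define p where "p x = c * x powr (- a)" for x
  define Q where "Q x = (\<Sum>i\<in>I. real (e i) * fact r * x ^ (v i - r) * p x ^ e i / min_edge_auts (H i))" for x
  have r: "1 < real r" using D a by simp
  have HL: "r_graph r (H i) \<and> edges (H i) \<noteq> {} \<and> card (edges (H i)) \<le> L" if "i \<in> I" for i
    using H[OF that] e[OF that] I(1) that by (auto simp: e_def L_def intro!: member_le_sum)
  have T_top: "filterlim T at_top sequentially"
  proof -
    have "filterlim (\<lambda>k. B * (real k powr a * ln (real k))) at_top sequentially"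
      using a B by real_asymp
    moreover have "filterlim (\<lambda>x. x powr (1 / D)) at_top at_top"
      using D(2) by real_asymp
    ultimately show ?thesis unfolding T_def by (rule filterlim_compose[rotated])
  qed
  have t_ge: "T k - 1 \<le> real (t k)" and t_le: "real (t k) \<le> T k" for k
  proof -
    have "0 \<le> T k" by (simp add: T_def)
    then show "T k - 1 \<le> real (t k)" "real (t k) \<le> T k" unfolding t_def by linarith+
  qed
  have t_top': "filterlim t at_top sequentially"
    unfolding t_def
    by (intro filterlim_compose[OF filterlim_nat_sequentially] filterlim_compose[OF filterlim_floor_sequentially] T_top)
  then have t_top: "filterlim (\<lambda>k. real (t k)) at_top sequentially"
    by (rule filterlim_compose[OF filterlim_real_sequentially])
  have n_top: "filterlim (\<lambda>k. real (k * t k)) at_top sequentially"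
    using filterlim_at_top_mult_at_top[OF filterlim_real_sequentially t_top] by simp
  \<comment> \<open>Multiplying \<open>root\<close> by \<open>fact r\<close> gives the limit 1/50,
    safely below the 1/10 that is required.\<close>
  have "((\<lambda>x. Q x / p x / (1 - p x) ^ L) \<longlongrightarrow> 1 / 50) at_top"
  proof -
    have "(\<Sum>i\<in>J. real (e i) * fact r * c ^ (e i - 1) / min_edge_auts (H i)) = fact r * (1 / (50 * fact r))"
      unfolding root[symmetric] sum_distrib_left by (intro sum.cong) auto
    also have "\<dots> = 1 / 50" by simp
    finally have limit: "(\<Sum>i\<in>J. real (e i) * fact r * c ^ (e i - 1) / min_edge_auts (H i)) = 1 / 50" .
    show ?thesis
      unfolding Q_def p_def limit[symmetric]
      by (rule copy_weight_tendsto[OF I c a]) (fact e J nJ)+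
  qed
  then have "eventually (\<lambda>x. Q x / p x / (1 - p x) ^ L < 1 / 10) at_top"
    by (rule order_tendstoD) simp
  then have Q: "eventually (\<lambda>x. Q x / (1 - p x) ^ L \<le> p x / 10) at_top"
    using eventually_gt_at_top[of 0]
  proof eventually_elim
    case (elim x)
    have "0 < p x" using c elim by (simp add: p_def)
    moreover have "Q x / p x / (1 - p x) ^ L = Q x / (1 - p x) ^ L / p x"
      by (simp add: mult.commute)
    ultimately have "Q x / (1 - p x) ^ L < 1 / 10 * p x"
      using elim by (simp only: pos_divide_less_eq)
    then show ?case by simp
  qed
  have p1: "eventually (\<lambda>x. p x < 1) at_top"
    unfolding p_def using a c by real_asymp
  have "eventually (\<lambda>n. 1 / 2 < real (n choose r) * fact r / real n ^ r) sequentially"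
    using binomial_asymptotic by (rule order_tendstoD) simp
  from eventually_compose_filterlim[OF this t_top']
  have choose: "eventually (\<lambda>k. 1 / 2 < real (t k choose r) * fact r / real (t k) ^ r) sequentially" .
  have "eventually (\<lambda>x. x powr D / 2 \<le> (x - 1) powr D) at_top"
    using D(2) by real_asymp
  note halve = eventually_compose_filterlim[OF this T_top]
  have ln5: "eventually (\<lambda>k. 5 \<le> ln (real k)) sequentially" by real_asymp
  have T1: "eventually (\<lambda>k. 1 \<le> T k) sequentially"
    using T_top by (simp add: filterlim_at_top)
  have t0: "eventually (\<lambda>k. 0 < t k) sequentially"
    by (rule eventually_compose_filterlim[OF eventually_gt_at_top t_top'])
  show ?thesis
    using choose halve ln5 T1 t0 eventually_compose_filterlim[OF Q n_top]
      eventually_compose_filterlim[OF p1 n_top] eventually_gt_at_top[of 0]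
  proof eventually_elim
    case (elim k)
    have k: "0 < real k" using elim by simp
    have X: "0 < real k powr a * ln (real k)"
      using elim(3) k by (intro mult_pos_pos) (simp, linarith)
    have TD: "T k powr D = B * (real k powr a * ln (real k))"
      using B X D(2) by (simp add: T_def powr_powr)
    have t_choose: "real (t k) ^ r / (2 * fact r) \<le> real (t k choose r)"
      using elim by (simp add: field_simps)
    have "4 * fact r / c * (real k powr a * ln (real k)) = T k powr D / 2"
      by (simp add: TD B_def)
    also have "\<dots> \<le> (T k - 1) powr D" using elim by simp
    also have "\<dots> \<le> real (t k) powr D"
      using elim D(2) t_ge by (intro powr_mono2) auto
    finally have t_large: "4 * fact r / c * (real k powr a * ln (real k)) \<le> real (t k) powr D" .
    have "ereal_of_enat (min_edges r k (H ` I))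
        < ereal (2 * c * real (k * t k) powr (real r - a) / fact r)"
    proof (rule min_edges_less_at[OF HL I(1) _ _ c D(1) p_def _ _ t_choose t_large])
      show "(\<Sum>i\<in>I. card (edges (H i)) * fact r * real (k * t k) ^ (card (verts (H i)) - r)
          * p (real (k * t k)) ^ card (edges (H i)) / min_edge_auts (H i)) / (1 - p (real (k * t k))) ^ L
        \<le> p (real (k * t k)) / 10"
        using elim(6) unfolding Q_def e_def v_def of_nat_mult of_nat_fact .
    qed (assumption | fact elim)+
    also have "2 * c * real (k * t k) powr (real r - a) / fact r
        \<le> 2 * c * (real k * T k) powr (real r - a) / fact r"
      using c D t_le[of k] by (intro divide_right_mono mult_left_mono powr_mono2) (auto intro: mult_left_mono)
    \<comment> \<open>Since \<open>D + a = r - 1\<close>, the \<open>D\<close>-th power of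
      \<open>k * T k\<close> is \<open>B * (k ^ (r - 1) * ln k)\<close>.\<close>
    also have "(real k * T k) powr (real r - a) = (B * (real k ^ (r - 1) * ln (real k))) powr ((real r - a) / D)"
    proof -
      have "real k = (real k powr D) powr (1 / D)"
        using D(2) k by (simp add: powr_powr)
      then have "real k * T k = (real k powr D * (B * (real k powr a * ln (real k)))) powr (1 / D)"
        unfolding T_def by (metis powr_mult)
      also have "real k powr D * (B * (real k powr a * ln (real k)))
          = B * ((real k powr D * real k powr a) * ln (real k))"
        by simp
      also have "real k powr D * real k powr a = real k powr (real (r - 1))"
        using r by (simp add: D powr_add[symmetric] of_nat_diff)
      also have "\<dots> = real k ^ (r - 1)" using k by (rule powr_realpow)
      finally show ?thesis by (simp add: powr_powr)
    qed
    also have "\<dots> = (8 * (fact r / c)) powr ((real r - a) / D) * (real k ^ (r - 1) * ln (real k)) powr ((real r - a) / D)"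
      unfolding powr_mult[symmetric] by (simp add: B_def)
    \<comment> \<open>As \<open>(r - a) / D = 1 + 1 / D\<close>, one full factor
      \<open>fact r / c\<close> splits off and cancels the \<open>c / fact r\<close> in
      front.\<close>
    also have "(8 * (fact r / c)) powr ((real r - a) / D) = 8 powr ((real r - a) / D) * (fact r / c * (fact r / c) powr (1 / D))"
    proof -
      have "(real r - a) / D = 1 + 1 / D" using D by (simp add: field_simps)
      then have "(fact r / c) powr ((real r - a) / D) = fact r / c * (fact r / c) powr (1 / D)"
        using c by (simp add: powr_add)
      then show ?thesis using c by (subst powr_mult) auto
    qed
    finally show ?case using c by (simp add: mult_ac)
  qed
qed

section \<open>Deduction of the theorem and comparison of the constants\<close>

text \<open>With at most \<open>r\<close> vertices every edge would be the whole vertex set. The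
  strict inequality makes the denominator of \<open>density\<close> positive.\<close>

lemma nontrivial_r_graph_card_verts:
  assumes "r_graph r H" "nontrivial H"
  shows "r < card (verts H)"
proof -
  have "2 \<le> card (edges H)"
    using assms(2) by (simp add: nontrivial_def)
  then have "\<not> is_singleton (edges H)" "edges H \<noteq> {}"
    by (auto simp: is_singleton_altdef)
  then obtain d d' where d: "d \<in> edges H" "d' \<in> edges H" "d \<noteq> d'"
    by (metis is_singletonI' ex_in_conv)
  show ?thesis
  proof (rule ccontr)
    assume "\<not> r < card (verts H)"
    then have "f = verts H" if "f \<in> edges H" for f
      using r_graph_edge[OF assms(1) that] r_graph_finite(1)[OF assms(1)] by (intro card_seteq) auto
    with d show False by blast
  qed
qed

theorem theorem4:
  fixes r l s :: nat
    and H :: "nat \<Rightarrow> 'a hypergraph"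
    and e \<alpha> :: "nat \<Rightarrow> nat"
    and \<rho>' :: "nat \<Rightarrow> real"
    and \<rho> c1 c2 cH :: real
  assumes "2 \<le> r"
    and "\<And>i. i \<in> {1..l} \<Longrightarrow> r_graph r (H i) \<and> nontrivial (H i) \<and> balanced r (H i)"
    and "\<And>i. e i = card (edges (H i))"
    and "\<And>i. \<rho>' i = rho r (H i)"
    and "\<And>i. \<alpha> i = min_edge_auts (H i)"
    and "\<And>i. 1 \<le> i \<Longrightarrow> i < l \<Longrightarrow> \<rho>' i \<le> \<rho>' (i + 1)"
    and "1 \<le> s" and "s \<le> l"
    and "\<And>i. i \<in> {1..s} \<Longrightarrow> \<rho>' i = \<rho>"
    and "s < l \<Longrightarrow> \<rho> < \<rho>' (s + 1)"
    and "\<rho> > 1 / (real r - 1)"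
    and "c1 = (THE x. 0 < x \<and>
           (\<Sum>i=1..s. real (e i) * x ^ (e i - 1) / real (\<alpha> i)) = 1 / (50 * fact r))"
    and "c2 = Max ((\<lambda>i. (real (\<alpha> i) / (5 * real (e i) * c1 ^ (e i - 1) * fact r))
                          powr (1 / (real r - 1))) ` {1..s})"
    and "cH = 2 * (fact r / c1) powr (1 / (real r - 1 - 1 / \<rho>))
           * c2 powr ((real r - 1) * (real r - 1 / \<rho>) / (real r - 1 - 1 / \<rho>))
           * ((real r - 1) / (real r - 1 - 1 / \<rho>))
               powr ((real r - 1 / \<rho>) / (real r - 1 - 1 / \<rho>))"
  shows "10 powr (1 / (real r - 1)) \<le> c2 \<and>
    (\<forall>\<^sub>F k in sequentially.
       ereal_of_enat (min_edges r k (H ` {1..l}))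
         < ereal (cH * (real k ^ (r - 1) * ln (real k))
                    powr ((real r - 1 / \<rho>) / (real r - 1 - 1 / \<rho>))))"
proof
  define I where "I = {1..l}"
  define J where "J = {1..s}"
  define a where "a = 1 / \<rho>"
  define D where "D = real r - 1 - a"
  define m where "m i = e i - 1" for i
  define b :: real where "b = 1 / (50 * fact r)"
  have fin: "finite I" "J \<subseteq> I" and J0: "finite J" "J \<noteq> {}" "1 \<in> J"
    using assms(7,8) by (auto simp: I_def J_def)
  have HI: "r_graph r (H i)" "nontrivial (H i)" "balanced r (H i)" if "i \<in> I" for i
    using assms(2) that by (auto simp: I_def)
  have e2: "2 \<le> e i" and vr: "r < card (verts (H i))" and \<alpha>0: "0 < \<alpha> i" if "i \<in> I" for i
  proof -
    show "2 \<le> e i" using HI(2)[OF that] by (simp add: assms(3) nontrivial_def)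
    then have "edges (H i) \<noteq> {}" by (auto simp: assms(3))
    then show "0 < \<alpha> i" using min_edge_auts_pos[OF HI(1)[OF that]] by (simp add: assms(5))
    show "r < card (verts (H i))" using nontrivial_r_graph_card_verts HI that by blast
  qed
  have \<rho>: "0 < \<rho>" "0 < a" "0 < D"
  proof -
    have r1: "0 < real r - 1" using assms(1) by simp
    then show "0 < \<rho>" using assms(11) by (smt (verit) divide_pos_pos)
    then show "0 < a" by (simp add: a_def)
    show "0 < D" using assms(11) r1 \<open>0 < \<rho>\<close> by (simp add: D_def a_def field_simps)
  qed
  \<comment> \<open>Balancedness replaces the maximum over subhypergraphs by the density of
    \<open>H i\<close> itself.\<close>
  have \<rho>'_eq: "\<rho>' i * (real (card (verts (H i))) - real r) = real (e i) - 1" if "i \<in> I" for i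
    using HI(3)[OF that] vr[OF that] by (simp add: assms(3,4) balanced_def density_def)
  have \<rho>'_J: "a * (real (e i) - 1) = real (card (verts (H i))) - real r" if "i \<in> J" for i
    using \<rho>'_eq[of i] assms(9)[of i] that fin \<rho>(1) by (auto simp: J_def a_def field_simps)
  \<comment> \<open>The strict gap at \<open>s + 1\<close> is carried to all later indices by
    monotonicity.\<close>
  have \<rho>'_gt: "\<rho> < \<rho>' i" if "s < i" "i \<le> l" for i
  proof -
    have "Suc s \<le> i" using that by simp
    then show ?thesis using that(2)
    proof (induction i rule: dec_induct)
      case base
      then show ?case using assms(10) by simp
    next
      case (step j)
      then show ?case using assms(6)[of j] assms(7) by simp
    qed
  qed
  have \<rho>'_nJ: "real (card (verts (H i))) - real r < a * (real (e i) - 1)" if "i \<in> I - J" for i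
  proof -
    have "\<rho> < \<rho>' i" using \<rho>'_gt that by (auto simp: I_def J_def)
    then have "\<rho> * (real (card (verts (H i))) - real r) < real (e i) - 1"
      using \<rho>'_eq[of i] vr[of i] that by (metis Diff_iff diff_gt_0_iff_gt mult_strict_right_mono of_nat_less_iff)
    then show ?thesis using \<rho>(1) by (simp add: a_def field_simps)
  qed
  have "\<exists>!x. 0 < x \<and> (\<Sum>i\<in>J. real (e i) / real (\<alpha> i) * x ^ m i) = b"
  proof (rule ex1_positive_root[OF J0(1,2)])
    fix i assume "i \<in> J"
    then have "i \<in> I" using fin by auto
    from e2[OF this] \<alpha>0[OF this] show "0 < real (e i) / real (\<alpha> i)" "1 \<le> m i"
      by (auto simp: m_def)
  qed (simp add: b_def)
  then have "\<exists>!x. 0 < x \<and> (\<Sum>i=1..s. real (e i) * x ^ (e i - 1) / real (\<alpha> i)) = 1 / (50 * fact r)"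
    by (simp add: m_def b_def J_def)
  from theI'[OF this] have c1: "0 < c1"
      and root: "(\<Sum>i\<in>J. real (e i) * c1 ^ (e i - 1) / real (\<alpha> i)) = b"
    unfolding assms(12)[symmetric] by (simp_all add: J_def b_def)
  \<comment> \<open>One summand of the equation for \<open>c1\<close> is at most the total
    \<open>1 / (50 * fact r)\<close>; taking the reciprocal and dividing by
    \<open>5 * fact r\<close> leaves 10.\<close>
  have "10 \<le> real (\<alpha> 1) / (5 * real (e 1) * c1 ^ (e 1 - 1) * fact r)"
  proof -
    have "1 \<in> I" using J0 fin by auto
    have pos: "0 < real (e 1) * c1 ^ (e 1 - 1)" "0 < real (\<alpha> 1)"
      using e2[OF \<open>1 \<in> I\<close>] \<alpha>0[OF \<open>1 \<in> I\<close>] c1 by auto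
    have "real (e 1) * c1 ^ (e 1 - 1) / real (\<alpha> 1) \<le> b"
      unfolding root[symmetric] using c1 J0
      by (intro member_le_sum) auto
    then show ?thesis using pos by (simp add: b_def field_simps)
  qed
  then have "10 powr (1 / (real r - 1))
      \<le> (real (\<alpha> 1) / (5 * real (e 1) * c1 ^ (e 1 - 1) * fact r)) powr (1 / (real r - 1))"
    using assms(1) by (intro powr_mono2) auto
  also have "\<dots> \<le> c2"
    unfolding assms(13) using assms(7) by (intro Max_ge) auto
  finally show c2: "10 powr (1 / (real r - 1)) \<le> c2" .

  define E where "E = (real r - a) / D"
  have E: "0 < E" using \<rho> by (simp add: E_def D_def)
  \<comment> \<open>The 8 from \<open>B\<close> is absorbed by the power of \<open>c2\<close>; the
    remaining factor of \<open>cH\<close> is at least 1 because \<open>D < r - 1\<close>.\<close>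
  have "8 powr E < 10 powr E"
    using E by (intro powr_less_mono2) auto
  also have "10 powr E = (10 powr (1 / (real r - 1))) powr ((real r - 1) * E)"
    using assms(1) by (simp add: powr_powr)
  also have "\<dots> \<le> c2 powr ((real r - 1) * E)"
    using c2 E assms(1) by (intro powr_mono2) auto
  also have "\<dots> = c2 powr ((real r - 1) * (real r - a) / D) * 1"
    by (simp add: E_def)
  also have "\<dots> \<le> c2 powr ((real r - 1) * (real r - a) / D) * ((real r - 1) / D) powr E"
  proof (rule mult_left_mono)
    have "1 \<le> (real r - 1) / D" using \<rho> by (simp add: D_def)
    then show "1 \<le> ((real r - 1) / D) powr E" using E by (intro ge_one_powr_ge_zero) auto
  qed simp
  finally have const: "2 * (fact r / c1) powr (1 / D) * 8 powr E \<le> cH"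
    unfolding assms(14) a_def[symmetric] D_def[symmetric] E_def[symmetric] mult.assoc
    by (intro mult_left_mono) auto
  have ev: "\<forall>\<^sub>F k in sequentially. ereal_of_enat (min_edges r k (H ` I))
    < ereal (2 * (fact r / c1) powr (1 / D) * 8 powr ((real r - a) / D)
        * (real k ^ (r - 1) * ln (real k)) powr ((real r - a) / D))"
  proof (rule eventually_min_edges_less[OF HI(1) fin c1 \<rho>(2) D_def \<rho>(3)])
    show "1 \<le> card (edges (H i)) \<and> r \<le> card (verts (H i))" if "i \<in> I" for i
      using e2[OF that] vr[OF that] by (simp add: assms(3))
    show "a * (real (card (edges (H i))) - 1) = real (card (verts (H i))) - real r" if "i \<in> J" for i
      using \<rho>'_J[OF that] by (simp add: assms(3))
    show "real (card (verts (H i))) - real r < a * (real (card (edges (H i))) - 1)" if "i \<in> I - J" for i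
      using \<rho>'_nJ[OF that] by (simp only: assms(3))
    show "(\<Sum>i\<in>J. real (card (edges (H i))) * c1 ^ (card (edges (H i)) - 1) / real (min_edge_auts (H i)))
        = 1 / (50 * fact r)"
      using root by (simp only: assms(3,5) b_def)
  qed
  show "\<forall>\<^sub>F k in sequentially.
       ereal_of_enat (min_edges r k (H ` {1..l}))
         < ereal (cH * (real k ^ (r - 1) * ln (real k))
                    powr ((real r - 1 / \<rho>) / (real r - 1 - 1 / \<rho>)))"
    using ev
  proof eventually_elim
    case (elim k)
    have "2 * (fact r / c1) powr (1 / D) * 8 powr E * (real k ^ (r - 1) * ln (real k)) powr E
        \<le> cH * (real k ^ (r - 1) * ln (real k)) powr E"
      by (intro mult_right_mono const) simp
    with elim show ?case
      unfolding E_def D_def a_def I_def by (meson ereal_less_eq(3) less_le_trans)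
  qed
qed

end
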